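(* Let $\mathbb{H}$ and $\mathbb{K}$ be complex Hilbert spaces, and let $A$ be a bounded linear operator on $\mathbb{H}$ and $B$ a bounded linear operator on $\mathbb{K}$. Then $$w(A \otimes B) \geq \frac{\|A\|\|B\|}{2}+ \frac{\Big|\,\|A \otimes B+iA^* \otimes B^*\|-\|A \otimes B-iA^* \otimes B^*\|\,\Big|}{4}.$$
   Context: For a bounded linear operator $T$ on a complex Hilbert space with inner product $\langle\cdot,\cdot\rangle$, the numerical radius is $w(T)=\sup\{|\langle Tx,x\rangle| : \|x\|=1\}$, and $\|T\|$ is the operator norm. Here $i$ is the imaginary unit. $\mathbb{H}\otimes\mathbb{K}$ is the Hilbert space tensor product (the completion of the algebraic tensor product under the inner product determined by $\langle x\otimes y,z\otimes u\rangle=\langle x,z\rangle\langle y,u\rangle$), and $A\otimes B$ is the bounded linear operator on $\mathbb{H}\otimes\mathbb{K}$ determined by $(A\otimes B)(x\otimes y)=Ax\otimes By$. *)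

theory Defs
  imports "HOL-Analysis.Analysis"
begin

section \<open>Complex inner product spaces and Hilbert spaces\<close>

text \<open>
  A complex inner product space is presented on top of the library class
  \<^class>\<open>real_inner\<close>, so that its norm and topology are the library's.  The real inner
  product is forced to be the real part of the complex one, hence
  \<open>norm x = sqrt (Re (cinner x x))\<close>.  The complex inner product is linear in its first argument.
\<close>

class complex_inner = real_inner +
  fixes scaleC :: "complex \<Rightarrow> 'a \<Rightarrow> 'a"  (infixr "*\<^sub>C" 75)
    and cinner :: "'a \<Rightarrow> 'a \<Rightarrow> complex"
  assumes scaleC_add_right: "c *\<^sub>C (x + y) = c *\<^sub>C x + c *\<^sub>C y"
    and scaleC_add_left: "(c + d) *\<^sub>C x = c *\<^sub>C x + d *\<^sub>C x"
    and scaleC_scaleC: "c *\<^sub>C (d *\<^sub>C x) = (c * d) *\<^sub>C x"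
    and scaleR_scaleC: "r *\<^sub>R x = complex_of_real r *\<^sub>C x"
    and cinner_commute: "cinner x y = cnj (cinner y x)"
    and cinner_add_left: "cinner (x + y) z = cinner x z + cinner y z"
    and cinner_scaleC_left: "cinner (c *\<^sub>C x) y = c * cinner x y"
    and inner_Re_cinner: "inner x y = Re (cinner x y)"

class chilbert_space = complex_inner + complete_space

lemma scaleC_one: "1 *\<^sub>C x = (x::'a::complex_inner)"
  using scaleR_scaleC[of 1 x] by simp

lemma scaleC_zero_left: "0 *\<^sub>C x = (0::'a::complex_inner)"
  using scaleR_scaleC[of 0 x] by simp

lemma scaleC_minus_one: "(-1) *\<^sub>C x = - (x::'a::complex_inner)"
  using scaleR_scaleC[of "-1" x] by simp

lemma cinner_add_right: "cinner x (y + z) = cinner x y + cinner x (z::'a::complex_inner)"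
  by (metis cinner_commute cinner_add_left complex_cnj_add)

lemma cinner_scaleC_right: "cinner x (c *\<^sub>C y) = cnj c * cinner x (y::'a::complex_inner)"
  by (metis cinner_commute cinner_scaleC_left complex_cnj_mult)

lemma cinner_zero_left: "cinner 0 (x::'a::complex_inner) = 0"
  using cinner_add_left[of 0 0 x] by simp

lemma cinner_zero_right: "cinner (x::'a::complex_inner) 0 = 0"
  using cinner_add_right[of x 0 0] by simp

lemma cinner_minus_left: "cinner (- x) y = - cinner x (y::'a::complex_inner)"
  using cinner_add_left[of x "- x" y] by (simp add: cinner_zero_left add_eq_0_iff)

lemma cinner_minus_right: "cinner x (- y) = - cinner x (y::'a::complex_inner)"
  using cinner_add_right[of x y "- y"] by (simp add: cinner_zero_right add_eq_0_iff)

lemma cinner_diff_left: "cinner (x - y) z = cinner x z - cinner y (z::'a::complex_inner)"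
  using cinner_add_left[of x "- y" z] by (simp add: cinner_minus_left)

lemma cinner_diff_right: "cinner x (y - z) = cinner x y - cinner x (z::'a::complex_inner)"
  using cinner_add_right[of x y "- z"] by (simp add: cinner_minus_right)

lemma cinner_self: "cinner x x = complex_of_real ((norm (x::'a::complex_inner))\<^sup>2)"
proof -
  have "Im (cinner x x) = 0"
    using cinner_commute[of x x] by (simp add: complex_eq_iff)
  moreover have "Re (cinner x x) = (norm x)\<^sup>2"
    by (simp add: power2_norm_eq_inner inner_Re_cinner)
  ultimately show ?thesis by (simp add: complex_eq_iff)
qed

lemma norm_scaleC: "norm (c *\<^sub>C x) = cmod c * norm (x::'a::complex_inner)"
proof -
  have "cinner (c *\<^sub>C x) (c *\<^sub>C x) = (c * cnj c) * cinner x x"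
    by (simp add: cinner_scaleC_left cinner_scaleC_right)
  hence "complex_of_real ((norm (c *\<^sub>C x))\<^sup>2) = complex_of_real ((cmod c * norm x)\<^sup>2)"
    unfolding cinner_self complex_norm_square[symmetric] power_mult_distrib of_real_mult .
  hence "(norm (c *\<^sub>C x))\<^sup>2 = (cmod c * norm x)\<^sup>2"
    using of_real_eq_iff by blast
  thus ?thesis by (simp add: power2_eq_iff_nonneg)
qed

lemma cmod_cinner_le: "cmod (cinner x y) \<le> norm x * norm (y::'a::complex_inner)"
proof (cases "cinner x y = 0")
  case False
  define c where "c = cnj (cinner x y) / cmod (cinner x y)"
  have nc: "cmod c = 1" using False by (simp add: c_def norm_divide)
  have "cinner (c *\<^sub>C x) y = complex_of_real (cmod (cinner x y))"
    using False by (simp add: c_def cinner_scaleC_left mult.commute[of "cnj _"]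
        complex_norm_square[symmetric] power2_eq_square)
  hence "cmod (cinner x y) = inner (c *\<^sub>C x) y"
    by (simp add: inner_Re_cinner)
  also have "\<dots> \<le> norm (c *\<^sub>C x) * norm y" by (rule norm_cauchy_schwarz)
  finally show ?thesis by (simp add: norm_scaleC nc)
qed simp

lemma bounded_bilinear_cinner:
  "bounded_bilinear (cinner :: 'a::complex_inner \<Rightarrow> 'a \<Rightarrow> complex)"
proof
  show "\<exists>K. \<forall>x y. cmod (cinner x y) \<le> norm x * norm (y::'a) * K"
    using cmod_cinner_le by (intro exI[of _ 1]) auto
qed (simp_all add: cinner_add_left cinner_add_right cinner_scaleC_left cinner_scaleC_right
      scaleR_scaleC scaleR_conv_of_real)

lemma bounded_linear_scaleC:
  "bounded_linear (\<lambda>x. c *\<^sub>C (x::'a::complex_inner))"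
proof
  show "\<exists>K. \<forall>x. norm (c *\<^sub>C (x::'a)) \<le> norm x * K"
    by (intro exI[of _ "cmod c"]) (simp add: norm_scaleC)
qed (simp_all add: scaleC_add_right scaleR_scaleC scaleC_scaleC mult.commute)


section \<open>Bounded operators, adjoint, numerical radius\<close>

definition bounded_clinear :: "('a::complex_inner \<Rightarrow> 'b::complex_inner) \<Rightarrow> bool" where
  "bounded_clinear A \<longleftrightarrow> bounded_linear A \<and> (\<forall>c x. A (c *\<^sub>C x) = c *\<^sub>C A x)"

definition cadjoint :: "('a::chilbert_space \<Rightarrow> 'b::chilbert_space) \<Rightarrow> 'b \<Rightarrow> 'a" where
  "cadjoint A = (THE S. bounded_clinear S \<and> (\<forall>x y. cinner (A x) y = cinner x (S y)))"

text \<open>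
  The supremum is taken in the nonnegative reals: \<open>0\<close> is inserted because on the zero space there
  are no unit vectors and \<open>Sup {}\<close> is unspecified in \<^typ>\<open>real\<close>.  On any other space
  the extra element does not change the supremum.  The operator norm is the library's
  \<^const>\<open>onorm\<close>.
\<close>

definition numerical_radius :: "('a::complex_inner \<Rightarrow> 'a) \<Rightarrow> real" where
  "numerical_radius T = Sup (insert 0 {cmod (cinner (T x) x) | x. norm x = 1})"


section \<open>Completion of a complex inner product space\<close>

lemma Cauchy_const: "Cauchy (\<lambda>n::nat. c::'a::metric_space)"
  by (simp add: Cauchy_def)

definition cauchy_equiv :: "(nat \<Rightarrow> 'a::complex_inner) \<Rightarrow> (nat \<Rightarrow> 'a) \<Rightarrow> bool" where
  "cauchy_equiv X Y \<longleftrightarrow> Cauchy X \<and> Cauchy Y \<and> (\<lambda>n. X n - Y n) \<longlonglongrightarrow> 0"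

lemma cauchy_equiv_refl_iff: "cauchy_equiv X X \<longleftrightarrow> Cauchy X"
  by (simp add: cauchy_equiv_def)

lemma part_equivp_cauchy_equiv: "part_equivp (cauchy_equiv :: (nat \<Rightarrow> 'a::complex_inner) \<Rightarrow> _)"
proof (rule part_equivpI)
  show "\<exists>X :: nat \<Rightarrow> 'a. cauchy_equiv X X"
    by (intro exI[of _ "\<lambda>_. 0"]) (simp add: cauchy_equiv_def Cauchy_const)
  show "symp (cauchy_equiv :: (nat \<Rightarrow> 'a) \<Rightarrow> _)"
  proof (rule sympI)
    fix X Y :: "nat \<Rightarrow> 'a"
    assume "cauchy_equiv X Y"
    thus "cauchy_equiv Y X"
      using tendsto_minus[of "\<lambda>n. X n - Y n" 0 sequentially] by (simp add: cauchy_equiv_def)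
  qed
  show "transp (cauchy_equiv :: (nat \<Rightarrow> 'a) \<Rightarrow> _)"
  proof (rule transpI)
    fix X Y Z :: "nat \<Rightarrow> 'a"
    assume "cauchy_equiv X Y" "cauchy_equiv Y Z"
    moreover from this have "(\<lambda>n. (X n - Y n) + (Y n - Z n)) \<longlonglongrightarrow> 0 + 0"
      unfolding cauchy_equiv_def by (intro tendsto_add) auto
    ultimately show "cauchy_equiv X Z" by (simp add: cauchy_equiv_def)
  qed
qed

quotient_type (overloaded) 'a completion = "nat \<Rightarrow> 'a::complex_inner" / partial: cauchy_equiv
  by (rule part_equivp_cauchy_equiv)

lemma Cauchy_add:
  fixes X Y :: "nat \<Rightarrow> 'a::real_normed_vector"
  assumes "Cauchy X" "Cauchy Y" shows "Cauchy (\<lambda>n. X n + Y n)"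
proof (rule CauchyI)
  fix e :: real assume "0 < e"
  then obtain M N where M: "\<And>m n. m \<ge> M \<Longrightarrow> n \<ge> M \<Longrightarrow> norm (X m - X n) < e/2"
    and N: "\<And>m n. m \<ge> N \<Longrightarrow> n \<ge> N \<Longrightarrow> norm (Y m - Y n) < e/2"
    using CauchyD[OF assms(1), of "e/2"] CauchyD[OF assms(2), of "e/2"] by (meson half_gt_zero)
  have "norm ((X m + Y m) - (X n + Y n)) < e" if "m \<ge> max M N" "n \<ge> max M N" for m n
    using norm_triangle_ineq[of "X m - X n" "Y m - Y n"] M[of m n] N[of m n] that
    by (simp add: algebra_simps)
  thus "\<exists>M. \<forall>m\<ge>M. \<forall>n\<ge>M. norm ((X m + Y m) - (X n + Y n)) < e" by blast
qed

lemma Cauchy_cinner: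
  fixes X Y :: "nat \<Rightarrow> 'a::complex_inner"
  assumes "Cauchy X" "Cauchy Y" shows "Cauchy (\<lambda>n. cinner (X n) (Y n))"
proof (rule CauchyI)
  fix e :: real assume e: "0 < e"
  obtain K where K: "K > 0" "\<And>n. norm (X n) \<le> K"
    using Cauchy_Bseq[OF assms(1)] by (auto elim: BseqE)
  obtain L where L: "L > 0" "\<And>n. norm (Y n) \<le> L"
    using Cauchy_Bseq[OF assms(2)] by (auto elim: BseqE)
  obtain M N where M: "\<And>m n. m \<ge> M \<Longrightarrow> n \<ge> M \<Longrightarrow> norm (X m - X n) < e/(2*L)"
    and N: "\<And>m n. m \<ge> N \<Longrightarrow> n \<ge> N \<Longrightarrow> norm (Y m - Y n) < e/(2*K)"
    using CauchyD[OF assms(1), of "e/(2*L)"] CauchyD[OF assms(2), of "e/(2*K)"] e K(1) L(1)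
    by (meson divide_pos_pos mult_pos_pos zero_less_numeral)
  have "norm (cinner (X m) (Y m) - cinner (X n) (Y n)) < e" if "m \<ge> max M N" "n \<ge> max M N" for m n
  proof -
    have "cmod (cinner (X m - X n) (Y m)) \<le> norm (X m - X n) * L"
      using cmod_cinner_le[of "X m - X n" "Y m"] L(2)[of m]
      by (meson mult_left_mono norm_ge_zero order_trans)
    also have "\<dots> < e/(2*L) * L"
      using M[of m n] that L(1) by (intro mult_strict_right_mono) auto
    finally have 1: "cmod (cinner (X m - X n) (Y m)) < e/2" using L(1) by simp
    have "cmod (cinner (X n) (Y m - Y n)) \<le> K * norm (Y m - Y n)"
      using cmod_cinner_le[of "X n" "Y m - Y n"] K(2)[of n]
      by (meson mult_right_mono norm_ge_zero order_trans)
    also have "\<dots> < K * (e/(2*K))"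
      using N[of m n] that K(1) by (intro mult_strict_left_mono) auto
    finally have 2: "cmod (cinner (X n) (Y m - Y n)) < e/2" using K(1) by simp
    have "cinner (X m) (Y m) - cinner (X n) (Y n)
        = cinner (X m - X n) (Y m) + cinner (X n) (Y m - Y n)"
      by (simp add: cinner_diff_left cinner_diff_right)
    thus ?thesis using 1 2
      norm_triangle_ineq[of "cinner (X m - X n) (Y m)" "cinner (X n) (Y m - Y n)"] by simp
  qed
  thus "\<exists>M. \<forall>m\<ge>M. \<forall>n\<ge>M. norm (cinner (X m) (Y m) - cinner (X n) (Y n)) < e" by blast
qed

lemma cinner_seq_LIMSEQ:
  fixes X Y :: "nat \<Rightarrow> 'a::complex_inner"
  assumes "Cauchy X" "Cauchy Y"
  shows "(\<lambda>n. cinner (X n) (Y n)) \<longlonglongrightarrow> lim (\<lambda>n. cinner (X n) (Y n))"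
  using Cauchy_cinner[OF assms] by (simp add: Cauchy_convergent_iff convergent_LIMSEQ_iff)

lemma cinner_seq_diff_tendsto_0:
  fixes X Y :: "nat \<Rightarrow> 'a::complex_inner"
  assumes "Cauchy X" "Z \<longlonglongrightarrow> 0"
  shows "(\<lambda>n. cinner (X n) (Z n)) \<longlonglongrightarrow> 0" "(\<lambda>n. cinner (Z n) (X n)) \<longlonglongrightarrow> 0"
proof -
  obtain K where K: "K > 0" "\<And>n. norm (X n) \<le> K"
    using Cauchy_Bseq[OF assms(1)] by (auto elim: BseqE)
  have lim: "(\<lambda>n. K * norm (Z n)) \<longlonglongrightarrow> 0"
    using tendsto_mult_right_zero[OF tendsto_norm_zero[OF assms(2)], of K] by simp
  have le: "cmod (cinner (X n) (Z n)) \<le> K * norm (Z n)" for n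
    using cmod_cinner_le[of "X n" "Z n"] K(2)[of n]
    by (meson mult_right_mono norm_ge_zero order_trans)
  show 1: "(\<lambda>n. cinner (X n) (Z n)) \<longlonglongrightarrow> 0"
    by (rule Lim_null_comparison[OF _ lim]) (simp add: le)
  have "cmod (cinner (Z n) (X n)) \<le> K * norm (Z n)" for n
    using le[of n] cinner_commute[of "Z n" "X n"] by simp
  thus "(\<lambda>n. cinner (Z n) (X n)) \<longlonglongrightarrow> 0"
    by (intro Lim_null_comparison[OF _ lim]) simp
qed

instantiation completion :: (complex_inner) complex_inner
begin

lift_definition zero_completion :: "'a completion" is "\<lambda>_. 0"
  by (simp add: cauchy_equiv_def Cauchy_const)

lift_definition plus_completion :: "'a completion \<Rightarrow> 'a completion \<Rightarrow> 'a completion"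
  is "\<lambda>X Y n. X n + Y n"
proof -
  fix X X' Y Y' :: "nat \<Rightarrow> 'a"
  assume "cauchy_equiv X X'" "cauchy_equiv Y Y'"
  thus "cauchy_equiv (\<lambda>n. X n + Y n) (\<lambda>n. X' n + Y' n)"
    unfolding cauchy_equiv_def
    using tendsto_add[of "\<lambda>n. X n - X' n" 0 sequentially "\<lambda>n. Y n - Y' n" 0]
    by (auto intro: Cauchy_add simp: algebra_simps)
qed

lift_definition scaleC_completion :: "complex \<Rightarrow> 'a completion \<Rightarrow> 'a completion"
  is "\<lambda>c X n. c *\<^sub>C X n"
proof -
  fix c :: complex and X X' :: "nat \<Rightarrow> 'a"
  assume *: "cauchy_equiv X X'"
  have "(\<lambda>n. c *\<^sub>C (X n - X' n)) \<longlonglongrightarrow> c *\<^sub>C 0"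
    using * by (intro bounded_linear.tendsto[OF bounded_linear_scaleC])
      (simp add: cauchy_equiv_def)
  thus "cauchy_equiv (\<lambda>n. c *\<^sub>C X n) (\<lambda>n. c *\<^sub>C X' n)"
    using * by (simp add: cauchy_equiv_def bounded_linear.Cauchy[OF bounded_linear_scaleC]
        linear_diff[OF bounded_linear.linear[OF bounded_linear_scaleC]]
        linear_0[OF bounded_linear.linear[OF bounded_linear_scaleC]])
qed

definition scaleR_completion :: "real \<Rightarrow> 'a completion \<Rightarrow> 'a completion" where
  "scaleR_completion r x = complex_of_real r *\<^sub>C x"

definition uminus_completion :: "'a completion \<Rightarrow> 'a completion" where
  "uminus_completion x = (-1) *\<^sub>C x"

definition minus_completion :: "'a completion \<Rightarrow> 'a completion \<Rightarrow> 'a completion" where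
  "minus_completion x y = x + - y"

lift_definition cinner_completion :: "'a completion \<Rightarrow> 'a completion \<Rightarrow> complex"
  is "\<lambda>X Y. lim (\<lambda>n. cinner (X n) (Y n))"
proof -
  fix X X' Y Y' :: "nat \<Rightarrow> 'a"
  assume X: "cauchy_equiv X X'" and Y: "cauchy_equiv Y Y'"
  have "(\<lambda>n. cinner (X n - X' n) (Y n) + cinner (X' n) (Y n - Y' n)) \<longlonglongrightarrow> 0 + 0"
    using X Y unfolding cauchy_equiv_def
    by (intro tendsto_add cinner_seq_diff_tendsto_0) auto
  hence "(\<lambda>n. cinner (X n) (Y n) - cinner (X' n) (Y' n)) \<longlonglongrightarrow> 0"
    by (simp add: cinner_diff_left cinner_diff_right)
  moreover have "(\<lambda>n. cinner (X' n) (Y' n)) \<longlonglongrightarrow> lim (\<lambda>n. cinner (X' n) (Y' n))"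
    using X Y by (intro cinner_seq_LIMSEQ) (auto simp: cauchy_equiv_def)
  ultimately have "(\<lambda>n. (cinner (X n) (Y n) - cinner (X' n) (Y' n)) + cinner (X' n) (Y' n))
      \<longlonglongrightarrow> 0 + lim (\<lambda>n. cinner (X' n) (Y' n))"
    by (rule tendsto_add)
  thus "lim (\<lambda>n. cinner (X n) (Y n)) = lim (\<lambda>n. cinner (X' n) (Y' n))"
    by (intro limI) simp
qed

definition inner_completion :: "'a completion \<Rightarrow> 'a completion \<Rightarrow> real" where
  "inner_completion x y = Re (cinner x y)"

definition norm_completion :: "'a completion \<Rightarrow> real" where
  "norm_completion x = sqrt (inner x x)"

definition sgn_completion :: "'a completion \<Rightarrow> 'a completion" where
  "sgn_completion x = scaleR (inverse (norm x)) x"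

definition dist_completion :: "'a completion \<Rightarrow> 'a completion \<Rightarrow> real" where
  "dist_completion x y = norm (x - y)"

definition uniformity_completion :: "('a completion \<times> 'a completion) filter" where
  "uniformity_completion = (INF e\<in>{0 <..}. principal {(x, y). dist x y < e})"

definition open_completion :: "'a completion set \<Rightarrow> bool" where
  "open_completion U \<longleftrightarrow> (\<forall>x\<in>U. eventually (\<lambda>(x', y). x' = x \<longrightarrow> y \<in> U) uniformity)"

instance
proof
  fix x y z :: "'a completion" and a b :: real and c d :: complex
  show add_assoc: "x + y + z = x + (y + z)"
    by transfer (simp add: cauchy_equiv_refl_iff Cauchy_add add.assoc)
  show add_comm: "x + y = y + x"
    by transfer (simp add: cauchy_equiv_refl_iff Cauchy_add add.commute)
  show zero: "0 + x = x"
    by transfer (simp add: cauchy_equiv_refl_iff)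
  show distr: "c *\<^sub>C (x + y) = c *\<^sub>C x + c *\<^sub>C y" for c :: complex and x y :: "'a completion"
    by transfer (simp add: cauchy_equiv_refl_iff scaleC_add_right[symmetric] Cauchy_add
        bounded_linear.Cauchy[OF bounded_linear_scaleC])
  show distl: "(c + d) *\<^sub>C x = c *\<^sub>C x + d *\<^sub>C x" for c d :: complex and x :: "'a completion"
    by transfer (simp add: cauchy_equiv_refl_iff scaleC_add_left[symmetric] Cauchy_add
        bounded_linear.Cauchy[OF bounded_linear_scaleC])
  show assoc: "c *\<^sub>C d *\<^sub>C x = (c * d) *\<^sub>C x" for c d :: complex and x :: "'a completion"
    by transfer (simp add: cauchy_equiv_refl_iff scaleC_scaleC
        bounded_linear.Cauchy[OF bounded_linear_scaleC])
  have one: "1 *\<^sub>C x = x" for x :: "'a completion"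
    by transfer (simp add: cauchy_equiv_refl_iff scaleC_one)
  have zeroC: "0 *\<^sub>C x = 0" for x :: "'a completion"
    by transfer (simp add: cauchy_equiv_refl_iff scaleC_zero_left Cauchy_const)
  show "- x + x = 0"
    using distl[of "-1" 1 x] by (simp add: uminus_completion_def one zeroC)
  show "x - y = x + - y" by (simp add: minus_completion_def)
  show "a *\<^sub>R (x + y) = a *\<^sub>R x + a *\<^sub>R y" "(a + b) *\<^sub>R x = a *\<^sub>R x + b *\<^sub>R x"
    "a *\<^sub>R b *\<^sub>R x = (a * b) *\<^sub>R x" "1 *\<^sub>R x = x"
    by (simp_all add: scaleR_completion_def distr distl assoc one)
  show "sgn x = scaleR (inverse (norm x)) x" "dist x y = norm (x - y)"
    by (simp_all add: sgn_completion_def dist_completion_def)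
  show "(uniformity :: ('a completion \<times> 'a completion) filter)
      = (INF e\<in>{0 <..}. principal {(x, y). dist x y < e})"
    by (rule uniformity_completion_def)
  show "open U \<longleftrightarrow> (\<forall>x\<in>U. eventually (\<lambda>(x', y). x' = x \<longrightarrow> y \<in> U) uniformity)"
    for U :: "'a completion set"
    by (rule open_completion_def)
  show "a *\<^sub>R x = complex_of_real a *\<^sub>C x" by (rule scaleR_completion_def)
  show comm: "cinner x y = cnj (cinner y x)" for x y :: "'a completion"
  proof transfer
    fix X Y :: "nat \<Rightarrow> 'a" assume "cauchy_equiv X X" "cauchy_equiv Y Y"
    hence "(\<lambda>n. cinner (Y n) (X n)) \<longlonglongrightarrow> lim (\<lambda>n. cinner (Y n) (X n))"
      by (intro cinner_seq_LIMSEQ) (auto simp: cauchy_equiv_def)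
    hence "(\<lambda>n. cnj (cinner (Y n) (X n))) \<longlonglongrightarrow> cnj (lim (\<lambda>n. cinner (Y n) (X n)))"
      by (rule tendsto_cnj)
    thus "lim (\<lambda>n. cinner (X n) (Y n)) = cnj (lim (\<lambda>n. cinner (Y n) (X n)))"
      by (intro limI) (simp add: cinner_commute[symmetric])
  qed
  show add_left: "cinner (x + y) z = cinner x z + cinner y z" for x y z :: "'a completion"
  proof transfer
    fix X Y Z :: "nat \<Rightarrow> 'a"
    assume "cauchy_equiv X X" "cauchy_equiv Y Y" "cauchy_equiv Z Z"
    hence "(\<lambda>n. cinner (X n) (Z n) + cinner (Y n) (Z n))
        \<longlonglongrightarrow> lim (\<lambda>n. cinner (X n) (Z n)) + lim (\<lambda>n. cinner (Y n) (Z n))"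
      by (intro tendsto_add cinner_seq_LIMSEQ) (auto simp: cauchy_equiv_def)
    thus "lim (\<lambda>n. cinner (X n + Y n) (Z n))
        = lim (\<lambda>n. cinner (X n) (Z n)) + lim (\<lambda>n. cinner (Y n) (Z n))"
      by (intro limI) (simp add: cinner_add_left)
  qed
  show scale_left: "cinner (c *\<^sub>C x) y = c * cinner x y" for c and x y :: "'a completion"
  proof transfer
    fix c and X Y :: "nat \<Rightarrow> 'a" assume "cauchy_equiv X X" "cauchy_equiv Y Y"
    hence "(\<lambda>n. c * cinner (X n) (Y n)) \<longlonglongrightarrow> c * lim (\<lambda>n. cinner (X n) (Y n))"
      by (intro tendsto_mult tendsto_const cinner_seq_LIMSEQ) (auto simp: cauchy_equiv_def)
    thus "lim (\<lambda>n. cinner (c *\<^sub>C X n) (Y n)) = c * lim (\<lambda>n. cinner (X n) (Y n))"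
      by (intro limI) (simp add: cinner_scaleC_left)
  qed
  show "inner x y = Re (cinner x y)" by (rule inner_completion_def)
  show "inner x y = inner y x"
    using comm[of x y] by (simp add: inner_completion_def)
  show "inner (x + y) z = inner x z + inner y z"
    by (simp add: inner_completion_def add_left)
  show "inner (a *\<^sub>R x) y = a * inner x y"
    by (simp add: inner_completion_def scaleR_completion_def scale_left)
  show "norm x = sqrt (inner x x)" by (rule norm_completion_def)
  show "0 \<le> inner x x"
    unfolding inner_completion_def
  proof transfer
    fix X :: "nat \<Rightarrow> 'a" assume "cauchy_equiv X X"
    hence "(\<lambda>n. Re (cinner (X n) (X n))) \<longlonglongrightarrow> Re (lim (\<lambda>n. cinner (X n) (X n)))"
      by (intro tendsto_Re cinner_seq_LIMSEQ) (auto simp: cauchy_equiv_def)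
    thus "0 \<le> Re (lim (\<lambda>n. cinner (X n) (X n)))"
      by (rule LIMSEQ_le_const) (simp add: cinner_self)
  qed
  show "inner x x = 0 \<longleftrightarrow> x = 0"
    unfolding inner_completion_def
  proof transfer
    fix X :: "nat \<Rightarrow> 'a" assume X: "cauchy_equiv X X"
    hence lim: "(\<lambda>n. Re (cinner (X n) (X n))) \<longlonglongrightarrow> Re (lim (\<lambda>n. cinner (X n) (X n)))"
      by (intro tendsto_Re cinner_seq_LIMSEQ) (auto simp: cauchy_equiv_def)
    hence "(\<lambda>n. (norm (X n))\<^sup>2) \<longlonglongrightarrow> Re (lim (\<lambda>n. cinner (X n) (X n)))"
      by (simp add: cinner_self)
    hence "Re (lim (\<lambda>n. cinner (X n) (X n))) = 0 \<longleftrightarrow> (\<lambda>n. (norm (X n))\<^sup>2) \<longlonglongrightarrow> 0"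
      by (metis LIMSEQ_unique)
    also have "\<dots> \<longleftrightarrow> X \<longlonglongrightarrow> 0"
    proof
      assume "(\<lambda>n. (norm (X n))\<^sup>2) \<longlonglongrightarrow> 0"
      hence "(\<lambda>n. sqrt ((norm (X n))\<^sup>2)) \<longlonglongrightarrow> sqrt 0" by (rule tendsto_real_sqrt)
      thus "X \<longlonglongrightarrow> 0" by (simp add: tendsto_norm_zero_iff)
    next
      assume "X \<longlonglongrightarrow> 0"
      hence "(\<lambda>n. (norm (X n))\<^sup>2) \<longlonglongrightarrow> 0\<^sup>2" by (intro tendsto_power tendsto_norm_zero)
      thus "(\<lambda>n. (norm (X n))\<^sup>2) \<longlonglongrightarrow> 0" by simp
    qed
    also have "\<dots> \<longleftrightarrow> cauchy_equiv X (\<lambda>_. 0)"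
      using X by (simp add: cauchy_equiv_def Cauchy_const)
    finally show "Re (lim (\<lambda>n. cinner (X n) (X n))) = 0 \<longleftrightarrow> cauchy_equiv X (\<lambda>_. 0)" .
  qed
qed

end

lift_definition embed_completion :: "'a::complex_inner \<Rightarrow> 'a completion" is "\<lambda>x _. x"
  by (simp add: cauchy_equiv_refl_iff Cauchy_const)

lemma embed_completion_add: "embed_completion (x + y) = embed_completion x + embed_completion y"
  by transfer (simp add: cauchy_equiv_refl_iff Cauchy_const)

lemma embed_completion_scaleC: "embed_completion (c *\<^sub>C x) = c *\<^sub>C embed_completion x"
  by transfer (simp add: cauchy_equiv_refl_iff Cauchy_const)

lemma cinner_embed_completion: "cinner (embed_completion x) (embed_completion y) = cinner x y"
  by transfer (simp add: limI)

lemma embed_completion_diff: "embed_completion (x - y) = embed_completion x - embed_completion y"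
  using embed_completion_add[of x "- y"] embed_completion_scaleC[of "-1" y]
  by (simp add: scaleC_minus_one)

lemma norm_embed_completion: "norm (embed_completion x) = norm x"
  by (simp add: norm_eq_sqrt_inner inner_Re_cinner cinner_embed_completion)

lemma embed_completion_LIMSEQ:
  assumes "Cauchy X"
  shows "(\<lambda>n. embed_completion (X n)) \<longlonglongrightarrow> abs_completion X"
proof (rule LIMSEQ_I)
  fix e :: real assume e: "0 < e"
  then obtain N where N: "\<And>m n. m \<ge> N \<Longrightarrow> n \<ge> N \<Longrightarrow> norm (X m - X n) < e/2"
    using CauchyD[OF assms, of "e/2"] by auto
  have "norm (embed_completion (X n) - abs_completion X) < e" if n: "n \<ge> N" for n
  proof -
    define D where "D = (\<lambda>k. X n + (-1) *\<^sub>C X k)"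
    have cD: "Cauchy D"
      unfolding D_def using assms
      by (intro Cauchy_add Cauchy_const bounded_linear.Cauchy[OF bounded_linear_scaleC])
    have eq: "embed_completion (X n) - abs_completion X = abs_completion D"
      unfolding minus_completion_def uminus_completion_def D_def
      using assms
      by (subst scaleC_completion.abs_eq, simp add: cauchy_equiv_refl_iff)
        (subst embed_completion.abs_eq, subst plus_completion.abs_eq,
          auto simp: cauchy_equiv_refl_iff Cauchy_const
            bounded_linear.Cauchy[OF bounded_linear_scaleC])
    have "(\<lambda>k. Re (cinner (D k) (D k))) \<longlonglongrightarrow> Re (lim (\<lambda>k. cinner (D k) (D k)))"
      by (intro tendsto_Re cinner_seq_LIMSEQ cD)
    moreover have "Re (lim (\<lambda>k. cinner (D k) (D k))) = (norm (abs_completion D))\<^sup>2"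
      unfolding power2_norm_eq_inner inner_completion_def
      by (simp add: cinner_completion.abs_eq cauchy_equiv_refl_iff cD)
    ultimately have "(\<lambda>k. (norm (D k))\<^sup>2) \<longlonglongrightarrow> (norm (abs_completion D))\<^sup>2"
      by (simp add: cinner_self)
    moreover have "\<forall>k\<ge>N. (norm (D k))\<^sup>2 \<le> (e/2)\<^sup>2"
    proof (intro allI impI power_mono)
      show "norm (D k) \<le> e/2" if "k \<ge> N" for k
        using N[OF n that] by (simp add: D_def scaleC_minus_one)
    qed simp
    ultimately have "(norm (abs_completion D))\<^sup>2 \<le> (e/2)\<^sup>2"
      by (intro LIMSEQ_le_const2) auto
    hence "norm (abs_completion D) \<le> e/2" using e by (simp add: power2_le_iff_abs_le)
    thus ?thesis using e eq by simp
  qed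
  thus "\<exists>N. \<forall>n\<ge>N. norm (embed_completion (X n) - abs_completion X) < e" by blast
qed

lemma closure_range_embed_completion: "closure (range embed_completion) = UNIV"
proof -
  have "x \<in> closure (range embed_completion)" for x :: "'a completion"
  proof -
    obtain X where "cauchy_equiv X X" "abs_completion X = x"
      using Quotient_rep_reflp[OF Quotient_completion] Quotient_abs_rep[OF Quotient_completion]
      by metis
    thus ?thesis
      using embed_completion_LIMSEQ[of X] unfolding closure_sequential cauchy_equiv_refl_iff
      by (intro exI[of _ "\<lambda>n. embed_completion (X n)"]) auto
  qed
  thus ?thesis by blast
qed

instance completion :: (complex_inner) chilbert_space
proof
  fix S :: "nat \<Rightarrow> 'a completion"
  assume S: "Cauchy S"
  have "\<exists>a. norm (embed_completion a - S n) < inverse (real (Suc n))" for n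
  proof -
    have "S n \<in> closure (range embed_completion)" by (simp add: closure_range_embed_completion)
    thus ?thesis unfolding closure_approachable dist_norm by fastforce
  qed
  then obtain a where a: "\<And>n. norm (embed_completion (a n) - S n) < inverse (real (Suc n))"
    by metis
  have d0: "(\<lambda>n. embed_completion (a n) - S n) \<longlonglongrightarrow> 0"
    by (rule Lim_null_comparison[OF _ LIMSEQ_inverse_real_of_nat]) (intro always_eventually allI less_imp_le a)
  have "Cauchy (\<lambda>n. (embed_completion (a n) - S n) + S n)"
    using S LIMSEQ_imp_Cauchy[OF d0] by (intro Cauchy_add)
  hence "Cauchy a"
    by (simp add: Cauchy_def dist_norm embed_completion_diff[symmetric] norm_embed_completion)
  from embed_completion_LIMSEQ[OF this]
  have "(\<lambda>n. embed_completion (a n) - (embed_completion (a n) - S n)) \<longlonglongrightarrow> abs_completion a - 0"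
    by (intro tendsto_diff d0)
  thus "convergent S" by (auto simp: convergent_def)
qed


section \<open>The Hilbert space tensor product\<close>

text \<open>
  A finite formal sum \<open>\<Sum>\<^sub>i x\<^sub>i \<otimes> y\<^sub>i\<close> is represented by the list of the pairs
  \<open>(x\<^sub>i, y\<^sub>i)\<close>; scalar coefficients can be absorbed into the first component.  The
  algebraic tensor product over the complex numbers is the quotient by the congruence generated by
  commutativity of addition and the relations saying that \<open>\<otimes>\<close> is biadditive and
  balanced over the scalars.  The rule \<open>zero\<close> identifies \<open>0 \<otimes> y\<close> with the empty sum; it
  has to be listed because lists under concatenation form only a monoid.
\<close>

inductive tensor_eq ::
  "('h::complex_inner \<times> 'k::complex_inner) list \<Rightarrow> ('h \<times> 'k) list \<Rightarrow> bool" where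
  refl: "tensor_eq s s"
| sym: "tensor_eq s t \<Longrightarrow> tensor_eq t s"
| trans: "tensor_eq s t \<Longrightarrow> tensor_eq t u \<Longrightarrow> tensor_eq s u"
| append: "tensor_eq s s' \<Longrightarrow> tensor_eq t t' \<Longrightarrow> tensor_eq (s @ t) (s' @ t')"
| comm: "tensor_eq (s @ t) (t @ s)"
| zero: "tensor_eq [(0, y)] []"
| add_left: "tensor_eq [(x + x', y)] [(x, y), (x', y)]"
| add_right: "tensor_eq [(x, y + y')] [(x, y), (x, y')]"
| scale: "tensor_eq [(c *\<^sub>C x, y)] [(x, c *\<^sub>C y)]"

quotient_type (overloaded) ('h, 'k) atensor =
  "('h::complex_inner \<times> 'k::complex_inner) list" / tensor_eq
  by (intro equivpI reflpI sympI transpI) (auto intro: tensor_eq.intros)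

definition formal_cinner ::
  "('h::complex_inner \<times> 'k::complex_inner) list \<Rightarrow> ('h \<times> 'k) list \<Rightarrow> complex" where
  "formal_cinner s t = (\<Sum>(x, y)\<leftarrow>s. \<Sum>(z, u)\<leftarrow>t. cinner x z * cinner y u)"

lemma formal_cinner_simps:
  "formal_cinner [] t = 0"
  "formal_cinner s [] = 0"
  "formal_cinner [(x, y)] ((z, u) # t) = cinner x z * cinner y u + formal_cinner [(x, y)] t"
  by (induction s) (auto simp: formal_cinner_def)

lemma formal_cinner_append_left:
  "formal_cinner (s @ s') t = formal_cinner s t + formal_cinner s' t"
  by (simp add: formal_cinner_def)

lemma formal_cinner_Cons_left:
  "formal_cinner (p # s) t = formal_cinner [p] t + formal_cinner s t"
  using formal_cinner_append_left[of "[p]" s t] by simp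

lemma formal_cinner_Cons_right:
  "formal_cinner s (q # t) = formal_cinner s [q] + formal_cinner s t"
  by (simp add: formal_cinner_def case_prod_unfold sum_list_addf)

lemma formal_cinner_commute: "formal_cinner s t = cnj (formal_cinner t s)"
proof -
  have single: "formal_cinner [p] t = cnj (formal_cinner t [p])" for p and t :: "('a \<times> 'b) list"
  proof (induction t)
    case (Cons q t)
    have "formal_cinner [p] [q] = cnj (formal_cinner [q] [p])"
      using cinner_commute[of "fst p" "fst q"] cinner_commute[of "snd p" "snd q"]
      by (simp add: formal_cinner_def case_prod_unfold)
    thus ?case
      using Cons formal_cinner_Cons_right[of "[p]" q t] formal_cinner_Cons_left[of q t "[p]"]
      by simp
  qed (simp add: formal_cinner_simps)
  show ?thesis
  proof (induction s)
    case (Cons p s)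
    thus ?case
      using single[of p t] formal_cinner_Cons_left[of p s t] formal_cinner_Cons_right[of t p s]
      by simp
  qed (simp add: formal_cinner_simps)
qed

lemma formal_cinner_cong_left:
  assumes "tensor_eq s s'" shows "formal_cinner s t = formal_cinner s' t"
proof -
  have single: "formal_cinner s [q] = formal_cinner s' [q]" for q
    using assms
  proof induction
    case (scale c x y)
    thus ?case by (cases q) (simp add: formal_cinner_def cinner_scaleC_left cinner_scaleC_right)
  qed (cases q; simp add: formal_cinner_def cinner_zero_left cinner_add_left algebra_simps)+
  show ?thesis
  proof (induction t)
    case (Cons q t)
    thus ?case
      using single[of q] formal_cinner_Cons_right[of s q t] formal_cinner_Cons_right[of s' q t]
      by simp
  qed (simp add: formal_cinner_simps)
qed

lemma formal_cinner_cong: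
  assumes "tensor_eq s s'" "tensor_eq t t'"
  shows "formal_cinner s t = formal_cinner s' t'"
  using formal_cinner_cong_left[OF assms(1), of t] formal_cinner_cong_left[OF assms(2), of s']
    formal_cinner_commute[of s' t] formal_cinner_commute[of s' t'] by simp

text \<open>
  Every formal sum is equivalent to one with orthonormal first components.  This gives
  positivity and definiteness of the inner product on the algebraic tensor product.
\<close>

definition orthonormal_list :: "'h::complex_inner list \<Rightarrow> bool" where
  "orthonormal_list vs \<longleftrightarrow>
     sorted_wrt (\<lambda>u v. cinner u v = 0) vs \<and> (\<forall>v\<in>set vs. cinner v v = 1)"

lemma tensor_eq_Cons: "tensor_eq s t \<Longrightarrow> tensor_eq (p # s) (p # t)"
  using tensor_eq.append[OF tensor_eq.refl[of "[p]"]] by simp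

lemma tensor_eq_swap: "tensor_eq (p # q # s) (q # p # s)"
  using tensor_eq.append[OF tensor_eq.comm[of "[p]" "[q]"] tensor_eq.refl[of s]] by simp

lemma tensor_eq_replace: "tensor_eq [p] s \<Longrightarrow> tensor_eq (p # t) (s @ t)"
  using tensor_eq.append[OF _ tensor_eq.refl[of t]] by fastforce

lemma tensor_eq_orthogonalize:
  assumes "orthonormal_list (map fst zs)"
  shows "\<exists>r zs'. tensor_eq ((x, y) # zs) ((r, y) # zs') \<and> map fst zs' = map fst zs \<and>
    (\<forall>e\<in>set (map fst zs). cinner r e = 0)"
  using assms
proof (induction zs)
  case Nil
  show ?case by (intro exI[of _ x] exI[of _ "[]"]) (simp add: tensor_eq.refl)
next
  case (Cons p zs)
  obtain e w where p: "p = (e, w)" by (cases p)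
  have e1: "cinner e e = 1" and eo: "\<And>v. v \<in> set (map fst zs) \<Longrightarrow> cinner e v = 0"
    and on: "orthonormal_list (map fst zs)"
    using Cons.prems by (auto simp: orthonormal_list_def p)
  obtain r0 zs' where r0: "tensor_eq ((x, y) # zs) ((r0, y) # zs')" "map fst zs' = map fst zs"
    "\<And>v. v \<in> set (map fst zs) \<Longrightarrow> cinner r0 v = 0"
    using Cons.IH[OF on] by blast
  define c where "c = cinner r0 e"
  define r where "r = r0 - c *\<^sub>C e"
  note tr [trans] = tensor_eq.trans
  have "tensor_eq ((x, y) # (e, w) # zs) ((e, w) # (x, y) # zs)" by (rule tensor_eq_swap)
  also have "tensor_eq \<dots> ((e, w) # (r0, y) # zs')" by (intro tensor_eq_Cons r0)
  also have "tensor_eq \<dots> ((e, w) # (r, y) # (c *\<^sub>C e, y) # zs')"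
    using tensor_eq_replace[OF tensor_eq.add_left[of r "c *\<^sub>C e" y], of zs']
    by (intro tensor_eq_Cons) (simp add: r_def)
  also have "tensor_eq \<dots> ((r, y) # (e, w) # (c *\<^sub>C e, y) # zs')" by (rule tensor_eq_swap)
  also have "tensor_eq \<dots> ((r, y) # (e, w) # (e, c *\<^sub>C y) # zs')"
    using tensor_eq_replace[OF tensor_eq.scale[of c e y], of zs']
    by (intro tensor_eq_Cons) simp
  also have "tensor_eq \<dots> ((r, y) # (e, w + c *\<^sub>C y) # zs')"
    using tensor_eq_replace[OF tensor_eq.add_right[of e w "c *\<^sub>C y"], of zs']
    by (intro tensor_eq_Cons) (simp add: tensor_eq.sym)
  finally have "tensor_eq ((x, y) # p # zs) ((r, y) # (e, w + c *\<^sub>C y) # zs')" by (simp add: p)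
  moreover have "cinner r v = 0" if "v \<in> set (map fst (p # zs))" for v
  proof (cases "v = e")
    case True
    thus ?thesis by (simp add: r_def c_def cinner_diff_left cinner_scaleC_left e1)
  next
    case False
    hence "v \<in> set (map fst zs)" using that by (simp add: p)
    thus ?thesis using eo[of v] r0(3)[of v]
      by (simp add: r_def cinner_diff_left cinner_scaleC_left)
  qed
  ultimately show ?case
    by (intro exI[of _ r] exI[of _ "(e, w + c *\<^sub>C y) # zs'"]) (auto simp: r0(2) p)
qed

lemma tensor_eq_orthonormal:
  "\<exists>zs. tensor_eq s zs \<and> orthonormal_list (map fst zs)"
proof (induction s)
  case Nil
  show ?case by (intro exI[of _ "[]"]) (simp add: tensor_eq.refl orthonormal_list_def)
next
  case (Cons p s)
  obtain x y where p: "p = (x, y)" by (cases p)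
  obtain zs where zs: "tensor_eq s zs" "orthonormal_list (map fst zs)" using Cons by blast
  obtain r zs' where r: "tensor_eq ((x, y) # zs) ((r, y) # zs')" "map fst zs' = map fst zs"
    "\<And>e. e \<in> set (map fst zs) \<Longrightarrow> cinner r e = 0"
    using tensor_eq_orthogonalize[OF zs(2)] by blast
  note tr [trans] = tensor_eq.trans
  have step: "tensor_eq (p # s) ((r, y) # zs')"
    using tensor_eq.trans[OF tensor_eq_Cons[OF zs(1)] r(1)] by (simp add: p)
  show ?case
  proof (cases "r = 0")
    case True
    note step
    also have "tensor_eq ((r, y) # zs') zs'"
      using tensor_eq_replace[OF tensor_eq.zero[of y], of zs'] True by simp
    finally show ?thesis using r(2) zs(2) by auto
  next
    case False
    define v where "v = complex_of_real (inverse (norm r)) *\<^sub>C r"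
    have rv: "r = complex_of_real (norm r) *\<^sub>C v"
      using False by (simp add: v_def scaleC_scaleC scaleC_one flip: of_real_mult)
    have "cinner v v = 1"
      using False by (simp add: v_def cinner_self norm_scaleC norm_inverse)
    moreover have "\<And>e. e \<in> set (map fst zs) \<Longrightarrow> cinner v e = 0"
      using r(3) by (simp add: v_def cinner_scaleC_left)
    ultimately have "orthonormal_list (map fst ((v, complex_of_real (norm r) *\<^sub>C y) # zs'))"
      using zs(2) r(2) by (simp add: orthonormal_list_def)
    moreover have "tensor_eq (p # s) ((v, complex_of_real (norm r) *\<^sub>C y) # zs')"
    proof -
      note step
      also have "tensor_eq ((r, y) # zs') ((v, complex_of_real (norm r) *\<^sub>C y) # zs')"
        using tensor_eq_replace[OF tensor_eq.scale[of "complex_of_real (norm r)" v y], of zs']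
          rv by simp
      finally show ?thesis .
    qed
    ultimately show ?thesis by blast
  qed
qed

lemma formal_cinner_orthonormal:
  assumes "orthonormal_list (map fst zs)"
  shows "formal_cinner zs zs = complex_of_real (\<Sum>p\<leftarrow>zs. (norm (snd p))\<^sup>2)"
  using assms
proof (induction zs)
  case (Cons p zs)
  obtain e w where p: "p = (e, w)" by (cases p)
  have e1: "cinner e e = 1" and eo: "\<forall>v\<in>set (map fst zs). cinner e v = 0"
    and on: "orthonormal_list (map fst zs)"
    using Cons.prems by (auto simp: orthonormal_list_def p)
  have cross: "formal_cinner [p] zs = 0"
    using eo by (induction zs) (auto simp: p formal_cinner_def)
  hence "formal_cinner zs [p] = 0" using formal_cinner_commute[of zs "[p]"] by simp
  moreover have "formal_cinner (p # zs) (p # zs)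
      = formal_cinner [p] (p # zs) + formal_cinner zs (p # zs)"
    by (rule formal_cinner_Cons_left)
  moreover have "formal_cinner zs (p # zs) = formal_cinner zs [p] + formal_cinner zs zs"
    by (rule formal_cinner_Cons_right)
  moreover have "formal_cinner [p] (p # zs) = cinner w w"
    using cross e1 by (simp add: p formal_cinner_simps(3))
  ultimately show ?case using Cons.IH[OF on] by (simp add: p cinner_self)
qed (simp add: formal_cinner_def)

lemma tensor_eq_Nil_if_zero: "(\<forall>p\<in>set zs. snd p = 0) \<Longrightarrow> tensor_eq zs []"
proof (induction zs)
  case (Cons p zs)
  then obtain x where p: "p = (x, 0)" by (cases p) auto
  have "tensor_eq [p] [(0, 0)]"
    using tensor_eq.sym[OF tensor_eq.scale[of 0 x 0]] by (simp add: p scaleC_zero_left)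
  hence "tensor_eq [p] []" using tensor_eq.trans tensor_eq.zero by blast
  from tensor_eq.append[OF this Cons.IH] Cons.prems show ?case by simp
qed (simp add: tensor_eq.refl)

instantiation atensor :: (complex_inner, complex_inner) complex_inner
begin

lift_definition zero_atensor :: "('a, 'b) atensor" is "[]" .

lift_definition plus_atensor :: "('a, 'b) atensor \<Rightarrow> ('a, 'b) atensor \<Rightarrow> ('a, 'b) atensor"
  is "(@)" by (rule tensor_eq.append)

lift_definition scaleC_atensor :: "complex \<Rightarrow> ('a, 'b) atensor \<Rightarrow> ('a, 'b) atensor"
  is "\<lambda>c. map (\<lambda>(x, y). (c *\<^sub>C x, y))"
proof -
  fix c and s t :: "('a \<times> 'b) list"
  assume "tensor_eq s t"
  thus "tensor_eq (map (\<lambda>(x, y). (c *\<^sub>C x, y)) s) (map (\<lambda>(x, y). (c *\<^sub>C x, y)) t)"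
  proof induction
    case (zero y)
    have "c *\<^sub>C (0::'a) = 0" using scaleC_add_right[of c 0 "0::'a"] by simp
    thus ?case by (simp add: tensor_eq.zero)
  next
    case (scale d x y)
    thus ?case using tensor_eq.scale[of d "c *\<^sub>C x" y]
      by (simp add: scaleC_scaleC mult.commute)
  qed (auto simp: scaleC_add_right intro: tensor_eq.intros)
qed

definition scaleR_atensor :: "real \<Rightarrow> ('a, 'b) atensor \<Rightarrow> ('a, 'b) atensor" where
  "scaleR_atensor r x = complex_of_real r *\<^sub>C x"

definition uminus_atensor :: "('a, 'b) atensor \<Rightarrow> ('a, 'b) atensor" where
  "uminus_atensor x = (-1) *\<^sub>C x"

definition minus_atensor :: "('a, 'b) atensor \<Rightarrow> ('a, 'b) atensor \<Rightarrow> ('a, 'b) atensor" where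
  "minus_atensor x y = x + - y"

lift_definition cinner_atensor :: "('a, 'b) atensor \<Rightarrow> ('a, 'b) atensor \<Rightarrow> complex"
  is formal_cinner by (rule formal_cinner_cong)

definition inner_atensor :: "('a, 'b) atensor \<Rightarrow> ('a, 'b) atensor \<Rightarrow> real" where
  "inner_atensor x y = Re (cinner x y)"

definition norm_atensor :: "('a, 'b) atensor \<Rightarrow> real" where
  "norm_atensor x = sqrt (inner x x)"

definition sgn_atensor :: "('a, 'b) atensor \<Rightarrow> ('a, 'b) atensor" where
  "sgn_atensor x = scaleR (inverse (norm x)) x"

definition dist_atensor :: "('a, 'b) atensor \<Rightarrow> ('a, 'b) atensor \<Rightarrow> real" where
  "dist_atensor x y = norm (x - y)"

definition uniformity_atensor :: "(('a, 'b) atensor \<times> ('a, 'b) atensor) filter" where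
  "uniformity_atensor = (INF e\<in>{0 <..}. principal {(x, y). dist x y < e})"

definition open_atensor :: "('a, 'b) atensor set \<Rightarrow> bool" where
  "open_atensor U \<longleftrightarrow> (\<forall>x\<in>U. eventually (\<lambda>(x', y). x' = x \<longrightarrow> y \<in> U) uniformity)"

instance
proof
  fix x y z :: "('a, 'b) atensor" and a b :: real and c d :: complex
  show "x + y + z = x + (y + z)" by transfer (simp add: tensor_eq.refl)
  show "x + y = y + x" by transfer (rule tensor_eq.comm)
  show "0 + x = x" by transfer (simp add: tensor_eq.refl)
  show distr: "c *\<^sub>C (x + y) = c *\<^sub>C x + c *\<^sub>C y" for c :: complex and x y :: "('a, 'b) atensor"
    by transfer (simp add: tensor_eq.refl)
  show distl: "(c + d) *\<^sub>C x = c *\<^sub>C x + d *\<^sub>C x" for c d :: complex and x :: "('a, 'b) atensor"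
  proof transfer
    fix c d :: complex and s :: "('a \<times> 'b) list"
    let ?m = "\<lambda>c. map (\<lambda>(x, y). (c *\<^sub>C x, y))"
    show "tensor_eq (?m (c + d) s) (?m c s @ ?m d s)"
    proof (induction s)
      case (Cons p s)
      obtain x y where p: "p = (x, y)" by (cases p)
      have "tensor_eq ([((c + d) *\<^sub>C x, y)] @ ?m (c + d) s)
          ([(c *\<^sub>C x, y), (d *\<^sub>C x, y)] @ (?m c s @ ?m d s))"
        using tensor_eq.append[OF tensor_eq.add_left Cons] by (simp add: scaleC_add_left)
      moreover have "tensor_eq ([(c *\<^sub>C x, y)] @ (([(d *\<^sub>C x, y)] @ ?m c s) @ ?m d s))
          ([(c *\<^sub>C x, y)] @ ((?m c s @ [(d *\<^sub>C x, y)]) @ ?m d s))"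
        by (intro tensor_eq.append tensor_eq.refl tensor_eq.comm)
      ultimately show ?case using tensor_eq.trans by (fastforce simp: p)
    qed (simp add: tensor_eq.refl)
  qed
  show assoc: "c *\<^sub>C d *\<^sub>C x = (c * d) *\<^sub>C x" for c d :: complex and x :: "('a, 'b) atensor"
    by transfer (simp add: tensor_eq.refl case_prod_unfold scaleC_scaleC comp_def)
  have one: "1 *\<^sub>C x = x" for x :: "('a, 'b) atensor"
    by transfer (simp add: tensor_eq.refl case_prod_unfold scaleC_one)
  have zeroC: "0 *\<^sub>C x = 0" for x :: "('a, 'b) atensor"
  proof transfer
    show "tensor_eq (map (\<lambda>(x, y). (0 *\<^sub>C x, y)) s) []" for s :: "('a \<times> 'b) list"
    proof (induction s)
      case (Cons p s)
      thus ?case using tensor_eq.append[OF tensor_eq.zero[of "snd p"] Cons]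
        by (simp add: case_prod_unfold scaleC_zero_left)
    qed (simp add: tensor_eq.refl)
  qed
  show "- x + x = 0"
    using distl[of "-1" 1 x] by (simp add: uminus_atensor_def one zeroC)
  show "x - y = x + - y" by (simp add: minus_atensor_def)
  show "a *\<^sub>R (x + y) = a *\<^sub>R x + a *\<^sub>R y" "(a + b) *\<^sub>R x = a *\<^sub>R x + b *\<^sub>R x"
    "a *\<^sub>R b *\<^sub>R x = (a * b) *\<^sub>R x" "1 *\<^sub>R x = x"
    by (simp_all add: scaleR_atensor_def distr distl assoc one)
  show "sgn x = scaleR (inverse (norm x)) x" "dist x y = norm (x - y)"
    by (simp_all add: sgn_atensor_def dist_atensor_def)
  show "(uniformity :: (('a, 'b) atensor \<times> ('a, 'b) atensor) filter)
      = (INF e\<in>{0 <..}. principal {(x, y). dist x y < e})"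
    by (rule uniformity_atensor_def)
  show "open U \<longleftrightarrow> (\<forall>x\<in>U. eventually (\<lambda>(x', y). x' = x \<longrightarrow> y \<in> U) uniformity)"
    for U :: "('a, 'b) atensor set"
    by (rule open_atensor_def)
  show "a *\<^sub>R x = complex_of_real a *\<^sub>C x" by (rule scaleR_atensor_def)
  show comm: "cinner x y = cnj (cinner y x)" for x y :: "('a, 'b) atensor"
    by transfer (rule formal_cinner_commute)
  show add_left: "cinner (x + y) z = cinner x z + cinner y z" for x y z :: "('a, 'b) atensor"
    by transfer (rule formal_cinner_append_left)
  show scale_left: "cinner (c *\<^sub>C x) y = c * cinner x y" for c and x y :: "('a, 'b) atensor"
    by transfer (simp add: formal_cinner_def case_prod_unfold comp_def cinner_scaleC_left
        mult.assoc sum_list_const_mult)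
  show "inner x y = Re (cinner x y)" by (rule inner_atensor_def)
  show "inner x y = inner y x"
    using comm[of x y] by (simp add: inner_atensor_def)
  show "inner (x + y) z = inner x z + inner y z"
    by (simp add: inner_atensor_def add_left)
  show "inner (a *\<^sub>R x) y = a * inner x y"
    by (simp add: inner_atensor_def scaleR_atensor_def scale_left)
  show "norm x = sqrt (inner x x)" by (rule norm_atensor_def)
  show "0 \<le> inner x x"
    unfolding inner_atensor_def
  proof transfer
    fix s :: "('a \<times> 'b) list"
    obtain zs where zs: "tensor_eq s zs" "orthonormal_list (map fst zs)"
      using tensor_eq_orthonormal by blast
    have "formal_cinner s s = complex_of_real (\<Sum>p\<leftarrow>zs. (norm (snd p))\<^sup>2)"
      using formal_cinner_cong[OF zs(1) zs(1)] formal_cinner_orthonormal[OF zs(2)] by simp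
    thus "0 \<le> Re (formal_cinner s s)" by (auto intro!: sum_list_nonneg)
  qed
  show "inner x x = 0 \<longleftrightarrow> x = 0"
    unfolding inner_atensor_def
  proof transfer
    fix s :: "('a \<times> 'b) list"
    obtain zs where zs: "tensor_eq s zs" "orthonormal_list (map fst zs)"
      using tensor_eq_orthonormal by blast
    have eq: "formal_cinner s s = complex_of_real (\<Sum>p\<leftarrow>zs. (norm (snd p))\<^sup>2)"
      using formal_cinner_cong[OF zs(1) zs(1)] formal_cinner_orthonormal[OF zs(2)] by simp
    show "Re (formal_cinner s s) = 0 \<longleftrightarrow> tensor_eq s []"
    proof
      assume "Re (formal_cinner s s) = 0"
      hence "\<forall>p\<in>set zs. snd p = 0" 
        using sum_list_nonneg_eq_0_iff[of "map (\<lambda>p. (norm (snd p))\<^sup>2) zs"] by (fastforce simp: eq)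
      thus "tensor_eq s []" using tensor_eq.trans[OF zs(1) tensor_eq_Nil_if_zero] by blast
    next
      assume "tensor_eq s []"
      from formal_cinner_cong[OF this this] show "Re (formal_cinner s s) = 0"
        by (simp add: formal_cinner_def)
    qed
  qed
qed

end

lift_definition atensor_of :: "'h::complex_inner \<Rightarrow> 'k::complex_inner \<Rightarrow> ('h, 'k) atensor"
  is "\<lambda>x y. [(x, y)]" .

type_synonym ('h, 'k) htensor = "('h, 'k) atensor completion"

definition tensor :: "'h::chilbert_space \<Rightarrow> 'k::chilbert_space \<Rightarrow> ('h, 'k) htensor"
    (infixr "\<otimes>" 70) where
  "x \<otimes> y = embed_completion (atensor_of x y)"

definition tensor_op ::
  "('h::chilbert_space \<Rightarrow> 'h) \<Rightarrow> ('k::chilbert_space \<Rightarrow> 'k) \<Rightarrow> ('h, 'k) htensor \<Rightarrow> ('h, 'k) htensor"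
    (infixr "\<otimes>\<^sub>o\<^sub>p" 70) where
  "A \<otimes>\<^sub>o\<^sub>p B = (THE T. bounded_clinear T \<and> (\<forall>x y. T (x \<otimes> y) = A x \<otimes> B y))"

lemma cinner_tensor: "cinner (x \<otimes> y) (z \<otimes> u) = cinner x z * cinner y u"
  unfolding tensor_def cinner_embed_completion by transfer (simp add: formal_cinner_def)

lemma tensor_add_left: "(x + x') \<otimes> y = x \<otimes> y + x' \<otimes> y"
  unfolding tensor_def embed_completion_add[symmetric]
  by (rule arg_cong[of _ _ embed_completion]) (transfer, simp add: tensor_eq.add_left)

lemma tensor_add_right: "x \<otimes> (y + y') = x \<otimes> y + x \<otimes> y'"
  unfolding tensor_def embed_completion_add[symmetric]
  by (rule arg_cong[of _ _ embed_completion]) (transfer, simp add: tensor_eq.add_right)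

lemma tensor_scaleC_left: "(c *\<^sub>C x) \<otimes> y = c *\<^sub>C (x \<otimes> y)"
  unfolding tensor_def embed_completion_scaleC[symmetric]
  by (rule arg_cong[of _ _ embed_completion]) (transfer, simp add: tensor_eq.refl)

lemma tensor_scaleC_right: "x \<otimes> (c *\<^sub>C y) = c *\<^sub>C (x \<otimes> y)"
  unfolding tensor_scaleC_left[symmetric] unfolding tensor_def
  by (rule arg_cong[of _ _ embed_completion])
    (transfer, rule tensor_eq.sym[OF tensor_eq.scale])

lemma closure_span_tensor:
  "closure (span (range (\<lambda>(x, y). x \<otimes> y))) = (UNIV :: ('h::chilbert_space, 'k::chilbert_space) htensor set)"
proof -
  let ?S = "span (range (\<lambda>(x, y). x \<otimes> y)) :: ('h, 'k) htensor set"
  have "embed_completion (abs_atensor s) \<in> ?S" for s :: "('h \<times> 'k) list"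
  proof (induction s)
    case Nil
    have "embed_completion (abs_atensor []) = (0 :: ('h, 'k) htensor)"
      using embed_completion_scaleC[of 0 "abs_atensor [] :: ('h, 'k) atensor"]
      by (simp add: scaleC_zero_left zero_atensor_def)
    thus ?case by (simp add: span_zero)
  next
    case (Cons p s)
    have "abs_atensor (p # s) = atensor_of (fst p) (snd p) + abs_atensor s"
      by (simp add: atensor_of.abs_eq plus_atensor.abs_eq)
    hence "embed_completion (abs_atensor (p # s))
        = fst p \<otimes> snd p + embed_completion (abs_atensor s)"
      by (simp add: tensor_def embed_completion_add)
    moreover have "fst p \<otimes> snd p \<in> ?S" by (intro span_base) (auto intro!: rev_image_eqI[of p] simp: case_prod_unfold)
    ultimately show ?case using Cons by (simp add: span_add)
  qed
  hence "embed_completion t \<in> ?S" for t :: "('h, 'k) atensor"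
    using Quotient_abs_rep[OF Quotient_atensor, of t] by metis
  hence "range embed_completion \<subseteq> ?S" by blast
  from closure_mono[OF this] show ?thesis by (auto simp: closure_range_embed_completion)
qed

end

theory Submission
  imports Defs
begin

text \<open>
  Put \<open>T = A \<otimes> B\<close> and \<open>S = A\<^sup>* \<otimes> B\<^sup>*\<close>, so that \<open>S\<close> is the adjoint of \<open>T\<close>.  The
  inequality holds for every bounded operator \<open>T\<close> with adjoint \<open>S\<close>
  (\<open>numerical_radius_ge_onorm_adjoint\<close>).  Indeed, for a complex number \<open>u\<close> of modulus one the
  operator \<open>T + u S\<close> is a unimodular multiple of the self-adjoint operator
  \<open>c T + cnj c S\<close>, where \<open>c\<^sup>2 = cnj u\<close>.  The norm of a self-adjoint operator is the supremum of
  the absolute value of its quadratic form on unit vectors, and here this form is \<open>2 Re (c \<langle>T x, x\<rangle>)\<close>.  Hence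
  \<open>a = \<parallel>T + \<i> S\<parallel>\<close> and \<open>b = \<parallel>T - \<i> S\<parallel>\<close> are both at most \<open>2 w(T)\<close>.  Since
  \<open>max a b = (a + b)/2 + \<bar>a - b\<bar>/2\<close> and \<open>a + b \<ge> \<parallel>2 T\<parallel>\<close>, the bound follows; the
  product \<open>\<parallel>A\<parallel> \<parallel>B\<parallel>\<close> enters through \<open>\<parallel>A\<parallel> \<parallel>B\<parallel> \<le> \<parallel>A \<otimes> B\<parallel>\<close>, seen on elementary tensors.

  The rest is the construction of the operators, which the definitions describe by a property.
  The adjoint comes from the Riesz representation theorem, proved here by minimising
  \<open>\<parallel>x\<parallel>\<^sup>2 - 2 f x\<close>.  The tensor product of two operators is defined on formal sums.  It is bounded
  there because it is the composition of two maps that each change one factor only, and such a map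
  is estimated on a formal sum whose components in the other factor are orthonormal.  It then
  extends to the completion.
\<close>

section \<open>Bounded complex-linear operators\<close>

lemma bounded_clinear_bounded_linear: "bounded_clinear A \<Longrightarrow> bounded_linear A"
  by (simp add: bounded_clinear_def)

lemma bounded_clinear_add: "bounded_clinear A \<Longrightarrow> A (x + y) = A x + A y"
  by (simp add: bounded_clinear_def bounded_linear.linear linear_add)

lemma bounded_clinear_zero: "bounded_clinear A \<Longrightarrow> A 0 = 0"
  by (simp add: bounded_clinear_def bounded_linear.linear linear_0)

lemma bounded_clinear_scaleC: "bounded_clinear A \<Longrightarrow> A (c *\<^sub>C x) = c *\<^sub>C A x"
  by (simp add: bounded_clinear_def)

lemma bounded_clinearI:
  assumes "\<And>x y. A (x + y) = A x + A y" "\<And>c x. A (c *\<^sub>C x) = c *\<^sub>C A x"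
    "\<And>x. norm (A x) \<le> K * norm x"
  shows "bounded_clinear A"
  unfolding bounded_clinear_def
proof (intro conjI allI)
  show "bounded_linear A"
    by (rule bounded_linear_intro[where K = K])
      (simp_all add: assms scaleR_scaleC mult.commute[of _ K])
qed (simp add: assms)

lemma bounded_clinear_ident: "bounded_clinear (\<lambda>x. x)"
  by (rule bounded_clinearI[where K = 1]) auto

lemma bounded_clinear_norm_le:
  "bounded_clinear A \<Longrightarrow> norm (A x) \<le> onorm A * norm x"
  by (simp add: bounded_clinear_def onorm)

section \<open>The numerical radius and the adjoint\<close>

lemma bdd_above_numerical_range:
  fixes T :: "'a::complex_inner \<Rightarrow> 'a"
  assumes "bounded_clinear T"
  shows "bdd_above (insert 0 {cmod (cinner (T x) x) | x. norm x = 1})"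
proof (rule bdd_aboveI[of _ "onorm T"])
  fix r assume "r \<in> insert 0 {cmod (cinner (T x) x) | x. norm x = 1}"
  moreover have "cmod (cinner (T x) x) \<le> onorm T" if "norm x = 1" for x
    using cmod_cinner_le[of "T x" x] bounded_clinear_norm_le[OF assms, of x] that by simp
  moreover have "0 \<le> onorm T"
    using assms by (simp add: bounded_clinear_def onorm_pos_le)
  ultimately show "r \<le> onorm T" by auto
qed

lemma numerical_radius_nonneg: "bounded_clinear T \<Longrightarrow> 0 \<le> numerical_radius T"
  unfolding numerical_radius_def by (intro cSup_upper bdd_above_numerical_range) auto

lemma cinner_le_numerical_radius:
  fixes T :: "'a::complex_inner \<Rightarrow> 'a"
  assumes "bounded_clinear T"
  shows "cmod (cinner (T x) x) \<le> numerical_radius T * (norm x)\<^sup>2"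
proof (cases "x = 0")
  case True
  thus ?thesis by (simp add: cinner_zero_right)
next
  case False
  define e where "e = complex_of_real (inverse (norm x)) *\<^sub>C x"
  have "norm e = 1" using False by (simp add: e_def norm_scaleC norm_inverse)
  hence "cmod (cinner (T e) e) \<le> numerical_radius T"
    unfolding numerical_radius_def by (intro cSup_upper bdd_above_numerical_range assms) auto
  moreover have x: "x = complex_of_real (norm x) *\<^sub>C e"
    using False by (simp add: e_def scaleC_scaleC scaleC_one flip: of_real_mult)
  have "cinner (T x) x = complex_of_real ((norm x)\<^sup>2) * cinner (T e) e"
    by (subst (1 2) x) (simp add: bounded_clinear_scaleC[OF assms] cinner_scaleC_left
        cinner_scaleC_right power2_eq_square)
  ultimately show ?thesis
    by (simp add: norm_mult norm_power mult.commute[of _ "(norm x)\<^sup>2"] mult_left_mono)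
qed

text \<open>
  Polarisation turns a bound on the quadratic form of a symmetric operator into
  \<open>2 \<langle>H x, y\<rangle> \<le> M (\<parallel>x\<parallel>\<^sup>2 + \<parallel>y\<parallel>\<^sup>2)\<close>, which is then applied to the multiple \<open>y\<close> of \<open>H x\<close> that
  has the length of \<open>x\<close>.
\<close>

lemma symmetric_norm_le_quadratic_form_bound:
  fixes H :: "'a::real_inner \<Rightarrow> 'a"
  assumes lin: "linear H" and symm: "\<And>x y. inner (H x) y = inner x (H y)"
    and bound: "\<And>x. \<bar>inner (H x) x\<bar> \<le> M * (norm x)\<^sup>2"
  shows "norm (H x) \<le> M * norm x"
proof (cases "H x = 0 \<or> x = 0")
  case True
  have "0 \<le> M * (norm x)\<^sup>2" using bound[of x] by linarith
  thus ?thesis using True linear_0[OF lin] by (auto simp: zero_le_mult_iff)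
next
  case False
  have polar: "2 * inner (H x) y \<le> M * ((norm x)\<^sup>2 + (norm y)\<^sup>2)" for y
  proof -
    have "4 * inner (H x) y = inner (H (x + y)) (x + y) - inner (H (x - y)) (x - y)"
      using symm[of y x]
      by (simp add: linear_add[OF lin] linear_diff[OF lin] inner_add_left inner_add_right
          inner_diff_left inner_diff_right inner_commute)
    also have "\<dots> \<le> M * (norm (x + y))\<^sup>2 + M * (norm (x - y))\<^sup>2"
      using bound[of "x + y"] bound[of "x - y"] by linarith
    also have "\<dots> = 2 * (M * ((norm x)\<^sup>2 + (norm y)\<^sup>2))"
      by (simp add: power2_norm_eq_inner inner_add_left inner_add_right
          inner_diff_left inner_diff_right inner_commute algebra_simps)
    finally show ?thesis by simp
  qed
  define y where "y = (norm x / norm (H x)) *\<^sub>R H x"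
  have "inner (H x) y = norm x * norm (H x)"
    using False by (simp add: y_def power2_norm_eq_inner[symmetric] power2_eq_square)
  moreover have "norm y = norm x" using False by (simp add: y_def)
  ultimately have "norm x * norm (H x) \<le> norm x * (M * norm x)"
    using polar[of y] by (simp add: power2_eq_square algebra_simps)
  thus ?thesis using False by simp
qed

text \<open>
  The adjoint of \<open>T\<close> enters as any operator \<open>S\<close> with the defining identity.  The factor
  \<open>c\<close> with \<open>c\<^sup>2 = cnj u\<close> makes \<open>c (T + u S) = c T + cnj c S\<close> symmetric.
\<close>

lemma norm_add_unimodular_adjoint_le:
  fixes T S :: "'a::complex_inner \<Rightarrow> 'a"
  assumes T: "bounded_clinear T" and S: "bounded_clinear S"
    and adj: "\<And>x y. cinner (T x) y = cinner x (S y)" and u: "cmod u = 1"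
  shows "norm (T x + u *\<^sub>C S x) \<le> 2 * numerical_radius T * norm x"
proof -
  define c where "c = csqrt (cnj u)"
  have c2: "c\<^sup>2 = cnj u" by (simp add: c_def)
  have nc: "cmod c = 1" using u by (simp add: c_def)
  have "c * (c * u) = c * cnj c"
    using complex_norm_square[of u] complex_norm_square[of c] u nc c2
    by (simp add: power2_eq_square mult.assoc[symmetric] mult.commute[of "cnj u"])
  hence cu: "c * u = cnj c" using nc by auto
  have adj': "cinner (S x) y = cinner x (T y)" for x y
    using adj[of y x] cinner_commute by metis
  define H where "H = (\<lambda>x. c *\<^sub>C T x + cnj c *\<^sub>C S x)"
  have "norm (H x) \<le> 2 * numerical_radius T * norm x"
  proof (rule symmetric_norm_le_quadratic_form_bound)
    show "linear H"
      unfolding H_def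
      by (intro bounded_linear.linear bounded_linear_add bounded_clinear_bounded_linear[OF T]
          bounded_clinear_bounded_linear[OF S]
          bounded_linear_compose[OF bounded_linear_scaleC, of _ c]
          bounded_linear_compose[OF bounded_linear_scaleC, of _ "cnj c"])
    show "inner (H x) y = inner x (H y)" for x y
      by (simp add: H_def inner_Re_cinner cinner_add_left cinner_add_right cinner_scaleC_left
          cinner_scaleC_right adj adj')
    show "\<bar>inner (H x) x\<bar> \<le> 2 * numerical_radius T * (norm x)\<^sup>2" for x
    proof -
      let ?z = "cinner (T x) x"
      have "cinner (H x) x = c * ?z + cnj c * cnj ?z"
        using adj'[of x x] cinner_commute[of x "T x"]
        by (simp add: H_def cinner_add_left cinner_scaleC_left)
      hence "cmod (cinner (H x) x) \<le> cmod (c * ?z) + cmod (cnj c * cnj ?z)"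
        by (simp only: norm_triangle_ineq)
      hence "cmod (cinner (H x) x) \<le> 2 * cmod ?z"
        by (simp add: norm_mult nc)
      thus ?thesis
        using abs_Re_le_cmod[of "cinner (H x) x"] cinner_le_numerical_radius[OF T, of x]
        by (simp add: inner_Re_cinner)
    qed
  qed
  moreover have "H x = c *\<^sub>C (T x + u *\<^sub>C S x)"
    by (simp add: H_def scaleC_add_right scaleC_scaleC cu)
  ultimately show ?thesis by (simp add: norm_scaleC nc)
qed

lemma onorm_add_unimodular_adjoint_le:
  fixes T S :: "'a::complex_inner \<Rightarrow> 'a"
  assumes "bounded_clinear T" "bounded_clinear S"
    "\<And>x y. cinner (T x) y = cinner x (S y)" "cmod u = 1"
  shows "onorm (\<lambda>x. T x + u *\<^sub>C S x) \<le> 2 * numerical_radius T"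
  by (rule onorm_bound)
    (simp_all add: numerical_radius_nonneg norm_add_unimodular_adjoint_le assms)

theorem numerical_radius_ge_onorm_adjoint:
  fixes T S :: "'a::complex_inner \<Rightarrow> 'a"
  assumes T: "bounded_clinear T" and S: "bounded_clinear S"
    and adj: "\<And>x y. cinner (T x) y = cinner x (S y)"
  shows "numerical_radius T \<ge> onorm T / 2
    + \<bar>onorm (\<lambda>x. T x + \<i> *\<^sub>C S x) - onorm (\<lambda>x. T x - \<i> *\<^sub>C S x)\<bar> / 4"
proof -
  let ?P = "\<lambda>x. T x + \<i> *\<^sub>C S x" and ?M = "\<lambda>x. T x - \<i> *\<^sub>C S x"
  have minus: "?M = (\<lambda>x. T x + (- \<i>) *\<^sub>C S x)"
  proof
    fix x
    have "(- \<i>) *\<^sub>C S x = - (\<i> *\<^sub>C S x)"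
      using scaleC_scaleC[of "-1" \<i> "S x"] by (simp add: scaleC_minus_one)
    thus "?M x = T x + (- \<i>) *\<^sub>C S x" by simp
  qed
  have P: "onorm ?P \<le> 2 * numerical_radius T"
    by (rule onorm_add_unimodular_adjoint_le[OF T S adj]) simp
  have M: "onorm ?M \<le> 2 * numerical_radius T"
    unfolding minus by (rule onorm_add_unimodular_adjoint_le[OF T S adj]) simp
  have iS: "bounded_linear (\<lambda>x. \<i> *\<^sub>C S x)"
    by (intro bounded_linear_compose[OF bounded_linear_scaleC] bounded_clinear_bounded_linear S)
  have T': "bounded_linear T" using T by (rule bounded_clinear_bounded_linear)
  have bl: "bounded_linear ?P" "bounded_linear ?M"
    by (rule bounded_linear_add[OF T' iS], rule bounded_linear_sub[OF T' iS])
  have "2 * onorm T = onorm (\<lambda>x. 2 *\<^sub>R T x)"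
    using onorm_scaleR[OF T', of 2] by simp
  also have "(\<lambda>x. 2 *\<^sub>R T x) = (\<lambda>x. ?P x + ?M x)" by (simp add: scaleR_2)
  also have "onorm \<dots> \<le> onorm ?P + onorm ?M" by (rule onorm_triangle[OF bl])
  finally have sum: "2 * onorm T \<le> onorm ?P + onorm ?M" .
  have "w \<ge> n / 2 + \<bar>a - b\<bar> / 4" if "2 * n \<le> a + b" "a \<le> 2 * w" "b \<le> 2 * w" for a b n w :: real
    using that by (simp add: abs_if field_simps)
  from this[OF sum P M] show ?thesis .
qed

section \<open>Existence of the adjoint\<close>

text \<open>
  The representing vector minimises \<open>J x = \<parallel>x\<parallel>\<^sup>2 - 2 f x\<close>.  The parallelogram law makes every
  minimising sequence Cauchy, and the vanishing of the derivative of \<open>J\<close> at a minimum is the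
  claimed identity.
\<close>

lemma riesz_representation:
  fixes f :: "'a::{real_inner, complete_space} \<Rightarrow> real"
  assumes "bounded_linear f"
  shows "\<exists>z. \<forall>x. f x = inner x z"
proof -
  interpret f: bounded_linear f by fact
  define J where "J x = (norm x)\<^sup>2 - 2 * f x" for x
  define m where "m = Inf (range J)"
  have "J x \<ge> - (onorm f)\<^sup>2" for x
  proof -
    have "f x \<le> onorm f * norm x" using onorm[OF assms, of x] by simp
    moreover have "0 \<le> (norm x - onorm f)\<^sup>2" by simp
    ultimately show ?thesis by (simp add: J_def power2_diff algebra_simps)
  qed
  hence bdd: "bdd_below (range J)" by (intro bdd_belowI2)
  have m_le: "m \<le> J x" for x unfolding m_def by (intro cInf_lower bdd) simp
  have "\<exists>x. J x < m + inverse (real (Suc n))" for n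
    using cInf_lessD[of "range J" "m + inverse (real (Suc n))"] by (auto simp: m_def)
  then obtain X where X: "\<And>n. J (X n) < m + inverse (real (Suc n))" by metis
  have par: "(norm (x - y))\<^sup>2 = 2 * J x + 2 * J y - 4 * J ((1/2) *\<^sub>R (x + y))" for x y
    by (simp add: J_def f.add f.scaleR power2_norm_eq_inner inner_add_left inner_add_right
        inner_diff_left inner_diff_right inner_commute algebra_simps)
  have "Cauchy X"
  proof (rule CauchyI)
    fix e :: real assume e: "0 < e"
    then obtain N where N: "inverse (real (Suc N)) < e\<^sup>2 / 4"
      using reals_Archimedean[of "e\<^sup>2 / 4"] by auto
    have J: "J (X n) < m + e\<^sup>2 / 4" if "n \<ge> N" for n
    proof -
      have "inverse (real (Suc n)) \<le> inverse (real (Suc N))"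
        using that by (intro le_imp_inverse_le) auto
      thus ?thesis using X[of n] N by linarith
    qed
    have "norm (X i - X j) < e" if "i \<ge> N" "j \<ge> N" for i j
    proof -
      have "(norm (X i - X j))\<^sup>2 < e\<^sup>2"
        using par[of "X i" "X j"] J[OF that(1)] J[OF that(2)] m_le[of "(1/2) *\<^sub>R (X i + X j)"]
        by linarith
      thus ?thesis using e by (simp add: power_less_imp_less_base)
    qed
    thus "\<exists>M. \<forall>i\<ge>M. \<forall>j\<ge>M. norm (X i - X j) < e" by blast
  qed
  then obtain z where z: "X \<longlonglongrightarrow> z" using Cauchy_convergent convergent_def by blast
  have "(\<lambda>n. J (X n)) \<longlonglongrightarrow> J z"
    unfolding J_def by (intro tendsto_intros f.tendsto z)
  moreover have "(\<lambda>n. m + inverse (real (Suc n))) \<longlonglongrightarrow> m + 0"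
    by (intro tendsto_intros LIMSEQ_inverse_real_of_nat)
  ultimately have "J z \<le> m"
    using X by (intro LIMSEQ_le[of "\<lambda>n. J (X n)" "J z" "\<lambda>n. m + inverse (real (Suc n))" m])
      (auto intro!: exI[of _ 0] less_imp_le)
  hence min: "J z \<le> J x" for x using m_le[of x] by linarith
  have "f y = inner y z" for y
  proof -
    define d where "d = inner y z - f y"
    \<comment> \<open>The quadratic \<open>t \<mapsto> J (z + t y)\<close> is least at \<open>- d / \<parallel>y\<parallel>\<^sup>2\<close>; adding one to the
      denominator includes \<open>y = 0\<close>.\<close>
    define s where "s = (norm y)\<^sup>2 + 1"
    have s: "s > 0" "(norm y)\<^sup>2 < s" by (simp_all add: s_def add_nonneg_pos)
    have step: "J (z + t *\<^sub>R y) = J z + 2 * t * d + t\<^sup>2 * (norm y)\<^sup>2" for t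
      by (simp add: J_def d_def f.add f.scaleR power2_norm_eq_inner inner_add_left
          inner_add_right inner_commute power2_eq_square[of t] algebra_simps)
    \<comment> \<open>The step \<open>t = - d/s\<close> would decrease \<open>J\<close> by at least \<open>d\<^sup>2/s\<close>.\<close>
    have "0 \<le> 2 * (- d / s) * d + (- d / s)\<^sup>2 * (norm y)\<^sup>2"
      using min[of "z + (- d / s) *\<^sub>R y"] unfolding step by linarith
    also have "\<dots> \<le> 2 * (- d / s) * d + (- d / s)\<^sup>2 * s"
      using s by (intro add_left_mono mult_left_mono) auto
    also have "\<dots> = - (d\<^sup>2 / s)"
      using s by (simp add: power2_eq_square field_simps)
    finally have "d\<^sup>2 / s \<le> 0" by simp
    hence "d\<^sup>2 \<le> 0" using s by (simp add: divide_le_0_iff)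
    thus ?thesis by (simp add: d_def)
  qed
  thus ?thesis by blast
qed

lemma cinner_eqI:
  fixes x y :: "'a::complex_inner"
  assumes "\<And>z. cinner z x = cinner z y"
  shows "x = y"
  using assms[of "x - y"] by (metis cinner_diff_right cinner_self eq_iff_diff_eq_0
      of_real_eq_0_iff zero_eq_power2 norm_eq_zero)

text \<open>
  A real representing vector also represents the complex functional, because the imaginary part of
  a complex-linear functional is its real part after multiplication of the argument by \<open>- \<i>\<close>.
\<close>

lemma adjoint_exists:
  fixes A :: "'a::chilbert_space \<Rightarrow> 'b::chilbert_space"
  assumes A: "bounded_clinear A"
  shows "\<exists>S. bounded_clinear S \<and> (\<forall>x y. cinner (A x) y = cinner x (S y))"
proof -
  have "\<exists>z. \<forall>x. cinner (A x) y = cinner x z" for y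
  proof -
    have "bounded_linear (\<lambda>x. inner (A x) y)"
      by (rule bounded_linear_compose[OF bounded_linear_inner_left
            bounded_clinear_bounded_linear[OF A]])
    then obtain z where z: "\<And>x. inner (A x) y = inner x z"
      using riesz_representation by blast
    have "cinner (A x) y = cinner x z" for x
      using z[of x] z[of "(- \<i>) *\<^sub>C x"]
      by (simp add: complex_eq_iff inner_Re_cinner bounded_clinear_scaleC[OF A]
          cinner_scaleC_left)
    thus ?thesis by blast
  qed
  then obtain S where S: "\<And>x y. cinner (A x) y = cinner x (S y)" by metis
  have "bounded_clinear S"
  proof (rule bounded_clinearI)
    show "S (x + y) = S x + S y" for x y
      by (rule cinner_eqI) (simp add: cinner_add_right flip: S)
    show "S (c *\<^sub>C x) = c *\<^sub>C S x" for c x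
      by (rule cinner_eqI) (simp add: cinner_scaleC_right flip: S)
    show "norm (S y) \<le> onorm A * norm y" for y
    proof (cases "S y = 0")
      case True
      thus ?thesis
        using onorm_pos_le[OF bounded_clinear_bounded_linear[OF A]] by simp
    next
      case False
      have "(norm (S y))\<^sup>2 = cmod (cinner (S y) (S y))"
        unfolding cinner_self by (simp add: norm_power)
      also have "\<dots> = cmod (cinner (A (S y)) y)" by (simp add: S)
      also have "\<dots> \<le> norm (A (S y)) * norm y" by (rule cmod_cinner_le)
      also have "\<dots> \<le> (onorm A * norm (S y)) * norm y"
        by (intro mult_right_mono bounded_clinear_norm_le[OF A]) simp
      finally have "norm (S y) * norm (S y) \<le> norm (S y) * (onorm A * norm y)"
        by (simp add: power2_eq_square mult_ac)
      thus ?thesis using False by simp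
    qed
  qed
  thus ?thesis using S by blast
qed

lemma cadjoint:
  fixes A :: "'a::chilbert_space \<Rightarrow> 'b::chilbert_space"
  assumes "bounded_clinear A"
  shows "bounded_clinear (cadjoint A)" "cinner (A x) y = cinner x (cadjoint A y)"
proof -
  let ?P = "\<lambda>S. bounded_clinear S \<and> (\<forall>x y. cinner (A x) y = cinner x (S y))"
  obtain S where S: "?P S" using adjoint_exists[OF assms] by blast
  moreover have "R = S" if "?P R" for R
    using S that by (intro ext cinner_eqI) metis
  ultimately have "?P (cadjoint A)"
    unfolding cadjoint_def by (rule theI[where P = ?P])
  thus "bounded_clinear (cadjoint A)" "cinner (A x) y = cinner x (cadjoint A y)" by auto
qed

section \<open>Tensor products of operators on formal sums\<close>

lemma tensor_eq_map_prod:
  assumes A: "bounded_clinear A" and B: "bounded_clinear B" and "tensor_eq s t"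
  shows "tensor_eq (map (map_prod A B) s) (map (map_prod A B) t)"
  using assms(3)
proof induction
  case (zero y)
  show ?case by (simp add: bounded_clinear_zero[OF A] tensor_eq.zero)
next
  case (add_left x x' y)
  show ?case by (simp add: bounded_clinear_add[OF A] tensor_eq.add_left)
next
  case (add_right x y y')
  show ?case by (simp add: bounded_clinear_add[OF B] tensor_eq.add_right)
next
  case (scale c x y)
  show ?case
    by (simp add: bounded_clinear_scaleC[OF A] bounded_clinear_scaleC[OF B] tensor_eq.scale)
qed (simp_all add: tensor_eq.refl tensor_eq.append tensor_eq.comm,
    (blast intro: tensor_eq.sym tensor_eq.trans)+)

lemma tensor_eq_swap_factors:
  "tensor_eq s t \<Longrightarrow> tensor_eq (map prod.swap s) (map prod.swap t)"
proof (induction rule: tensor_eq.induct)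
  case (zero y)
  show ?case by (simp add: tensor_eq_Nil_if_zero)
next
  case (scale c x y)
  show ?case by (simp add: tensor_eq.sym[OF tensor_eq.scale])
qed (simp_all add: tensor_eq.refl tensor_eq.append tensor_eq.comm tensor_eq.add_left
    tensor_eq.add_right, (blast intro: tensor_eq.sym tensor_eq.trans)+)

lemma formal_cinner_swap:
  "formal_cinner (map prod.swap s) (map prod.swap t) = formal_cinner s t"
  by (simp add: formal_cinner_def case_prod_unfold comp_def mult.commute)

text \<open>
  On a sum \<open>\<Sum>\<^sub>i e\<^sub>i \<otimes> y\<^sub>i\<close> with orthonormal \<open>e\<^sub>i\<close> the squared norm is \<open>\<Sum>\<^sub>i \<parallel>y\<^sub>i\<parallel>\<^sup>2\<close>, and the map
  \<open>id \<otimes> B\<close> keeps the \<open>e\<^sub>i\<close>.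
\<close>

lemma formal_norm_map_snd_le:
  assumes B: "bounded_clinear B"
  shows "Re (formal_cinner (map (map_prod (\<lambda>x. x) B) s) (map (map_prod (\<lambda>x. x) B) s))
    \<le> (onorm B)\<^sup>2 * Re (formal_cinner s s)"
proof -
  let ?F = "map (map_prod (\<lambda>x. x) B)"
  obtain zs where zs: "tensor_eq s zs" "orthonormal_list (map fst zs)"
    using tensor_eq_orthonormal by blast
  have eq: "tensor_eq (?F s) (?F zs)"
    by (rule tensor_eq_map_prod[OF bounded_clinear_ident B zs(1)])
  have fst: "map fst (?F zs) = map fst zs" by (simp add: comp_def)
  have "formal_cinner (?F s) (?F s) = complex_of_real (\<Sum>p\<leftarrow>?F zs. (norm (snd p))\<^sup>2)"
    using formal_cinner_cong[OF eq eq] formal_cinner_orthonormal[of "?F zs", unfolded fst, OF zs(2)]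
    by simp
  hence "Re (formal_cinner (?F s) (?F s)) = (\<Sum>p\<leftarrow>zs. (norm (B (snd p)))\<^sup>2)"
    by (simp add: comp_def)
  also have "\<dots> \<le> (\<Sum>p\<leftarrow>zs. (onorm B)\<^sup>2 * (norm (snd p))\<^sup>2)"
    unfolding power_mult_distrib[symmetric]
    by (intro sum_list_mono power_mono bounded_clinear_norm_le[OF B]) simp
  also have "\<dots> = (onorm B)\<^sup>2 * Re (formal_cinner s s)"
    using formal_cinner_cong[OF zs(1) zs(1)] formal_cinner_orthonormal[OF zs(2)]
    by (simp add: sum_list_const_mult)
  finally show ?thesis .
qed

text \<open>
  Both factors of \<open>A \<otimes> B = (A \<otimes> id) (id \<otimes> B)\<close> are controlled by the preceding lemma, the first
  one after the two components are exchanged.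
\<close>

lemma formal_norm_map_prod_le:
  assumes A: "bounded_clinear A" and B: "bounded_clinear B"
  shows "Re (formal_cinner (map (map_prod A B) s) (map (map_prod A B) s))
    \<le> (onorm A * onorm B)\<^sup>2 * Re (formal_cinner s s)"
proof -
  let ?F = "map (map_prod (\<lambda>x. x) B)" and ?G = "map (map_prod (\<lambda>x. x) A)"
  have "map (map_prod A B) s = map prod.swap (?G (map prod.swap (?F s)))"
    by (induction s) (simp_all add: map_prod_def case_prod_unfold)
  hence "Re (formal_cinner (map (map_prod A B) s) (map (map_prod A B) s))
      = Re (formal_cinner (?G (map prod.swap (?F s))) (?G (map prod.swap (?F s))))"
    by (simp only: formal_cinner_swap)
  also have "\<dots> \<le> (onorm A)\<^sup>2 * Re (formal_cinner (?F s) (?F s))"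
    using formal_norm_map_snd_le[OF A, of "map prod.swap (?F s)"]
    by (simp only: formal_cinner_swap)
  also have "\<dots> \<le> (onorm A)\<^sup>2 * ((onorm B)\<^sup>2 * Re (formal_cinner s s))"
    by (intro mult_left_mono formal_norm_map_snd_le[OF B]) simp
  finally show ?thesis by (simp add: power_mult_distrib mult_ac)
qed

text \<open>
  The componentwise map respects the equivalence of formal sums when both operators are linear, but
  not in general; the empty sum is a dummy value that makes the operation total.
\<close>

lift_definition atensor_map :: "('a::complex_inner \<Rightarrow> 'c::complex_inner) \<Rightarrow>
    ('b::complex_inner \<Rightarrow> 'd::complex_inner) \<Rightarrow> ('a, 'b) atensor \<Rightarrow> ('c, 'd) atensor"
  is "\<lambda>A B s. if bounded_clinear A \<and> bounded_clinear B then map (map_prod A B) s else []"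
  by (simp add: tensor_eq_map_prod tensor_eq.refl)

lemma atensor_map_atensor_of:
  assumes "bounded_clinear A" "bounded_clinear B"
  shows "atensor_map A B (atensor_of x y) = atensor_of (A x) (B y)"
  using assms by transfer (simp add: tensor_eq.refl)

lemma map_prod_scale_fst:
  assumes "bounded_clinear A"
  shows "map (map_prod A B) (map (\<lambda>(x, y). (c *\<^sub>C x, y)) s)
    = map (\<lambda>(x, y). (c *\<^sub>C x, y)) (map (map_prod A B) s)"
  using assms by (induction s) (auto simp: bounded_clinear_scaleC[OF assms])

lemma bounded_clinear_atensor_map:
  assumes A: "bounded_clinear A" and B: "bounded_clinear B"
  shows "bounded_clinear (atensor_map A B)"
proof (rule bounded_clinearI)
  show "atensor_map A B (s + t) = atensor_map A B s + atensor_map A B t" for s t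
    using A B by transfer (simp add: tensor_eq.refl)
  show "atensor_map A B (c *\<^sub>C s) = c *\<^sub>C atensor_map A B s" for c s
    using A B
    by transfer (simp only: map_prod_scale_fst if_True simp_thms tensor_eq.refl)
  show "norm (atensor_map A B s) \<le> (onorm A * onorm B) * norm s" for s
  proof (rule power2_le_imp_le)
    show "(norm (atensor_map A B s))\<^sup>2 \<le> (onorm A * onorm B * norm s)\<^sup>2"
      unfolding power_mult_distrib[of "onorm A * onorm B"] power2_norm_eq_inner inner_Re_cinner
      using A B by transfer (simp add: formal_norm_map_prod_le)
    show "0 \<le> onorm A * onorm B * norm s"
      using A B by (simp add: bounded_clinear_def onorm_pos_le)
  qed
qed

section \<open>Extension to the completion\<close>

text \<open>
  A bounded linear map sends Cauchy sequences to Cauchy sequences termwise.  For other maps the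
  zero sequence is a dummy value.
\<close>

lift_definition completion_map ::
    "('a::complex_inner \<Rightarrow> 'b::complex_inner) \<Rightarrow> 'a completion \<Rightarrow> 'b completion"
  is "\<lambda>F X. if bounded_clinear F then (\<lambda>n. F (X n)) else (\<lambda>_. 0)"
proof -
  fix F :: "'a \<Rightarrow> 'b" and X Y :: "nat \<Rightarrow> 'a"
  assume XY: "cauchy_equiv X Y"
  show "cauchy_equiv (if bounded_clinear F then (\<lambda>n. F (X n)) else (\<lambda>_. 0))
      (if bounded_clinear F then (\<lambda>n. F (Y n)) else (\<lambda>_. 0))"
  proof (cases "bounded_clinear F")
    case True
    then interpret F: bounded_linear F by (rule bounded_clinear_bounded_linear)
    have "(\<lambda>n. F (X n - Y n)) \<longlonglongrightarrow> F 0"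
      using XY by (intro F.tendsto) (simp add: cauchy_equiv_def)
    thus ?thesis
      using XY True by (simp add: cauchy_equiv_def F.Cauchy F.diff F.zero)
  qed (simp add: cauchy_equiv_refl_iff Cauchy_const)
qed

lemma completion_map_embed:
  assumes "bounded_clinear F"
  shows "completion_map F (embed_completion x) = embed_completion (F x)"
  using assms by transfer (simp add: cauchy_equiv_refl_iff Cauchy_const)

lemma bounded_clinear_completion_map:
  assumes F: "bounded_clinear F"
  shows "bounded_clinear (completion_map F)"
proof (rule bounded_clinearI)
  have C: "Cauchy X \<Longrightarrow> Cauchy (\<lambda>n. F (X n))" for X
    by (rule bounded_linear.Cauchy[OF bounded_clinear_bounded_linear[OF F]])
  show "completion_map F (x + y) = completion_map F x + completion_map F y" for x y
    by (transfer fixing: F)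
      (simp add: F cauchy_equiv_refl_iff bounded_clinear_add[OF F] Cauchy_add C)
  show "completion_map F (c *\<^sub>C x) = c *\<^sub>C completion_map F x" for c x
    by (transfer fixing: F)
      (simp add: F cauchy_equiv_refl_iff bounded_clinear_scaleC[OF F] C
        bounded_linear.Cauchy[OF bounded_linear_scaleC])
  show "norm (completion_map F x) \<le> onorm F * norm x" for x
  proof -
    obtain X where X: "cauchy_equiv X X" "abs_completion X = x"
      using Quotient_rep_reflp[OF Quotient_completion] Quotient_abs_rep[OF Quotient_completion]
      by metis
    hence CX: "Cauchy X" by (simp add: cauchy_equiv_refl_iff)
    have "completion_map F x = abs_completion (\<lambda>n. F (X n))"
      using completion_map.abs_eq[OF X(1), of F] X(2) F by simp
    hence 1: "(\<lambda>n. norm (F (X n))) \<longlonglongrightarrow> norm (completion_map F x)"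
      using tendsto_norm[OF embed_completion_LIMSEQ[OF C[OF CX]]]
      by (simp add: norm_embed_completion)
    have 2: "(\<lambda>n. onorm F * norm (X n)) \<longlonglongrightarrow> onorm F * norm x"
      using tendsto_norm[OF embed_completion_LIMSEQ[OF CX]]
      by (intro tendsto_mult tendsto_const) (simp add: norm_embed_completion X(2))
    show ?thesis
      by (rule LIMSEQ_le[OF 1 2]) (simp add: bounded_clinear_norm_le[OF F])
  qed
qed

section \<open>The tensor product of two operators\<close>

text \<open>Elementary tensors span a dense subspace.\<close>

lemma bounded_linear_eq_on_tensors:
  fixes f g :: "('h::chilbert_space, 'k::chilbert_space) htensor \<Rightarrow> 'b::real_normed_vector"
  assumes f: "bounded_linear f" and g: "bounded_linear g"
    and eq: "\<And>x y. f (x \<otimes> y) = g (x \<otimes> y)"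
  shows "f t = g t"
proof -
  let ?S = "span (range (\<lambda>(x, y). x \<otimes> y)) :: ('h, 'k) htensor set"
  have "f s = g s" if "s \<in> ?S" for s
    by (rule linear_eq_on_span[OF bounded_linear.linear[OF f] bounded_linear.linear[OF g] _ that])
      (auto simp: eq)
  hence "?S \<subseteq> {t. f t = g t}" by blast
  moreover have "closed {t. f t = g t}"
    using f g by (intro closed_Collect_eq linear_continuous_on)
  ultimately have "closure ?S \<subseteq> {t. f t = g t}" by (rule closure_minimal)
  thus ?thesis by (auto simp: closure_span_tensor)
qed

lemma tensor_op:
  fixes A :: "'h::chilbert_space \<Rightarrow> 'h" and B :: "'k::chilbert_space \<Rightarrow> 'k"
  assumes A: "bounded_clinear A" and B: "bounded_clinear B"
  shows "bounded_clinear (A \<otimes>\<^sub>o\<^sub>p B)" "(A \<otimes>\<^sub>o\<^sub>p B) (x \<otimes> y) = A x \<otimes> B y"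
proof -
  let ?P = "\<lambda>T. bounded_clinear T \<and> (\<forall>x y. T (x \<otimes> y) = A x \<otimes> B y)"
  note AB = bounded_clinear_atensor_map[OF A B]
  let ?T = "completion_map (atensor_map A B)"
  have T: "?P ?T"
    by (simp add: bounded_clinear_completion_map[OF AB] tensor_def completion_map_embed[OF AB]
        atensor_map_atensor_of[OF A B])
  moreover have "R = ?T" if "?P R" for R
    using T that
    by - (rule ext, rule bounded_linear_eq_on_tensors, auto simp: bounded_clinear_bounded_linear)
  ultimately have "?P (A \<otimes>\<^sub>o\<^sub>p B)"
    unfolding tensor_op_def by (rule theI[where P = ?P])
  thus "bounded_clinear (A \<otimes>\<^sub>o\<^sub>p B)" "(A \<otimes>\<^sub>o\<^sub>p B) (x \<otimes> y) = A x \<otimes> B y" by auto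
qed

lemma norm_tensor: "norm (x \<otimes> y) = norm x * norm y"
proof -
  have "(norm (x \<otimes> y))\<^sup>2 = (norm x * norm y)\<^sup>2"
    using cinner_tensor[of x y x y] unfolding cinner_self
    by (simp add: power_mult_distrib flip: of_real_mult of_real_power)
  thus ?thesis by (simp add: power2_eq_iff_nonneg)
qed

lemma onorm_mult_le_onorm_tensor_op:
  fixes A :: "'h::chilbert_space \<Rightarrow> 'h" and B :: "'k::chilbert_space \<Rightarrow> 'k"
  assumes A: "bounded_clinear A" and B: "bounded_clinear B"
  shows "onorm A * onorm B \<le> onorm (A \<otimes>\<^sub>o\<^sub>p B)"
proof -
  let ?N = "onorm (A \<otimes>\<^sub>o\<^sub>p B)"
  have A': "bounded_linear A" and B': "bounded_linear B"
    using A B by (simp_all add: bounded_clinear_bounded_linear)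
  have elem: "norm (A x) * norm (B y) \<le> ?N * norm x * norm y" for x y
    using bounded_clinear_norm_le[OF tensor_op(1)[OF A B], of "x \<otimes> y"]
    by (simp add: tensor_op(2)[OF A B] norm_tensor mult.assoc)
  have N: "0 \<le> ?N"
    by (intro onorm_pos_le bounded_clinear_bounded_linear tensor_op A B)
  \<comment> \<open>The supremum over \<open>x\<close> is taken first, with the number \<open>\<parallel>B y\<parallel>\<close> as a scalar factor.\<close>
  have "norm (B y) * onorm A \<le> ?N * norm y" for y
  proof -
    have "onorm (\<lambda>x. norm (B y) *\<^sub>R A x) \<le> ?N * norm y"
      using elem[of _ y] by (intro onorm_bound) (simp_all add: mult_ac N)
    thus ?thesis by (simp add: onorm_scaleR[OF A'])
  qed
  hence "onorm (\<lambda>y. onorm A *\<^sub>R B y) \<le> ?N"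
    using onorm_pos_le[OF A'] by (intro onorm_bound) (simp_all add: mult_ac N)
  thus ?thesis using onorm_pos_le[OF A'] by (simp add: onorm_scaleR[OF B'])
qed

lemma cinner_tensor_op:
  fixes A :: "'h::chilbert_space \<Rightarrow> 'h" and B :: "'k::chilbert_space \<Rightarrow> 'k"
  assumes A: "bounded_clinear A" and B: "bounded_clinear B"
  shows "cinner ((A \<otimes>\<^sub>o\<^sub>p B) s) t = cinner s ((cadjoint A \<otimes>\<^sub>o\<^sub>p cadjoint B) t)"
proof -
  note adj = cadjoint(1)[OF A] cadjoint(1)[OF B]
  let ?T = "A \<otimes>\<^sub>o\<^sub>p B" and ?S = "cadjoint A \<otimes>\<^sub>o\<^sub>p cadjoint B"
  have T: "bounded_linear ?T" and S: "bounded_linear ?S"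
    using tensor_op(1)[OF A B] tensor_op(1)[OF adj] by (simp_all add: bounded_clinear_bounded_linear)
  note left = bounded_bilinear.bounded_linear_left[OF bounded_bilinear_cinner]
    and right = bounded_bilinear.bounded_linear_right[OF bounded_bilinear_cinner]
  \<comment> \<open>Density is used in one argument at a time.\<close>
  have "cinner (?T (x \<otimes> y)) t = cinner (x \<otimes> y) (?S t)" for x y
    by (rule bounded_linear_eq_on_tensors[OF right bounded_linear_compose[OF right S]])
      (simp add: tensor_op(2)[OF A B] tensor_op(2)[OF adj] cinner_tensor
        cadjoint(2)[OF A] cadjoint(2)[OF B])
  thus ?thesis
    by (rule bounded_linear_eq_on_tensors[OF bounded_linear_compose[OF left T] left])
qed

theorem theorem2p11:
  fixes A :: "'h::chilbert_space \<Rightarrow> 'h" and B :: "'k::chilbert_space \<Rightarrow> 'k"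
  assumes "bounded_clinear A" and "bounded_clinear B"
  shows "numerical_radius (A \<otimes>\<^sub>o\<^sub>p B) \<ge> onorm A * onorm B / 2
    + \<bar>onorm (\<lambda>t. (A \<otimes>\<^sub>o\<^sub>p B) t + \<i> *\<^sub>C (cadjoint A \<otimes>\<^sub>o\<^sub>p cadjoint B) t)
       - onorm (\<lambda>t. (A \<otimes>\<^sub>o\<^sub>p B) t - \<i> *\<^sub>C (cadjoint A \<otimes>\<^sub>o\<^sub>p cadjoint B) t)\<bar> / 4"
  using numerical_radius_ge_onorm_adjoint[OF tensor_op(1)[OF assms]
      tensor_op(1)[OF cadjoint(1)[OF assms(1)] cadjoint(1)[OF assms(2)]] cinner_tensor_op[OF assms]]
    onorm_mult_le_onorm_tensor_op[OF assms]
  by linarith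

end
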